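(* Let $1<p<\infty$, $X=L_p[0,1]$, and let $C$ be the positive cone of $X$ with respect to the Haar basis $\{\chi_n\}_{n=1}^\infty$, i.e. $$C=\Big\{x=\sum_n a_n\chi_n\in X:\ a_n\ge0\text{ for all }n\in\mathbb N\Big\}.$$ Then for every $u\in C_N$, $(X_u,\|\cdot\|_u)$ is linearly isometric to $\ell_\infty$.
   Context: Real scalars. The Haar system is $\chi_1\equiv1$ and, for $k=0,1,2,\dots$, $j=1,\dots,2^k$, $\chi_{2^k+j}(t)=1$ for $t\in[(2j-2)2^{-k-1},(2j-1)2^{-k-1}]$, $-1$ for $t\in((2j-1)2^{-k-1},2j\,2^{-k-1}]$, and $0$ otherwise; it is an unconditional basis of $L_p[0,1]$ for $1<p<\infty$. For a closed convex set $C\subset X$, $C_N$ denotes the set of points $x\in C$ that are not support points, where $x\in C$ is a support point if there is a nonzero $x^*\in X^*$ with $\langle x^*,x\rangle=\max\{\langle x^*,y\rangle:y\in C\}$. With the order $x\ge y\iff x-y\in C$, $[-u,u]=\{x\in X:-u\le x\le u\}$, $X_u=C_u\cap(-C_u)$ with $C_u=\bigcup_{\lambda>0}\lambda(C-u)$ (equivalently $X_u=\bigcup_{\lambda>0}\lambda[-u,u]$), and $\|x\|_u=\inf\{\lambda>0:x\in\lambda[-u,u]\}$. *)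

theory Defs
  imports "HOL-Analysis.Analysis" "HOL-Library.Discrete_Functions"
begin

(* The type L0 of measurable functions on [0,1] modulo equality almost everywhere.  The exponent p
   is a term, so L_p[0,1] cannot itself be a type; it is the linear subspace Lp p of L0. *)

definition ae_eq :: "(real \<Rightarrow> real) \<Rightarrow> (real \<Rightarrow> real) \<Rightarrow> bool" where
  "ae_eq f g \<longleftrightarrow>
     f \<in> borel_measurable (lebesgue_on {0..1}) \<and>
     g \<in> borel_measurable (lebesgue_on {0..1}) \<and>
     (AE t in lebesgue_on {0..1}. f t = g t)"

lemma ae_eq_refl_iff: "ae_eq f f \<longleftrightarrow> f \<in> borel_measurable (lebesgue_on {0..1})"
  by (simp add: ae_eq_def)

lemma part_equivp_ae_eq: "part_equivp ae_eq"
proof (rule part_equivpI)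
  show "\<exists>f. ae_eq f f"
    by (rule exI[of _ "\<lambda>_. 0"]) (simp add: ae_eq_refl_iff)
  show "symp ae_eq"
    by (rule sympI) (auto simp: ae_eq_def eq_commute)
  show "transp ae_eq"
    by (rule transpI) (auto simp: ae_eq_def)
qed

quotient_type L0 = "real \<Rightarrow> real" / partial: ae_eq
  by (rule part_equivp_ae_eq)

instantiation L0 :: real_vector
begin

lift_definition zero_L0 :: L0 is "\<lambda>t. 0"
  by (simp add: ae_eq_refl_iff)

lift_definition plus_L0 :: "L0 \<Rightarrow> L0 \<Rightarrow> L0" is "\<lambda>f g t. f t + g t"
  by (auto simp: ae_eq_def)

lift_definition minus_L0 :: "L0 \<Rightarrow> L0 \<Rightarrow> L0" is "\<lambda>f g t. f t - g t"
  by (auto simp: ae_eq_def)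

lift_definition uminus_L0 :: "L0 \<Rightarrow> L0" is "\<lambda>f t. - f t"
  by (auto simp: ae_eq_def)

lift_definition scaleR_L0 :: "real \<Rightarrow> L0 \<Rightarrow> L0" is "\<lambda>c f t. c * f t"
  by (auto simp: ae_eq_def)

instance
  by standard (transfer; auto simp: ae_eq_def algebra_simps)+

end

lift_definition Lp_mem :: "real \<Rightarrow> L0 \<Rightarrow> bool" is
  "\<lambda>p f. integrable (lebesgue_on {0..1}) (\<lambda>t. \<bar>f t\<bar> powr p)"
proof -
  fix p :: real and f g :: "real \<Rightarrow> real"
  assume "ae_eq f g"
  then have [measurable]: "f \<in> borel_measurable (lebesgue_on {0..1})"
      "g \<in> borel_measurable (lebesgue_on {0..1})"
    and "AE t in lebesgue_on {0..1}. f t = g t"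
    by (auto simp: ae_eq_def)
  then show "integrable (lebesgue_on {0..1}) (\<lambda>t. \<bar>f t\<bar> powr p) =
      integrable (lebesgue_on {0..1}) (\<lambda>t. \<bar>g t\<bar> powr p)"
    by (intro integrable_cong_AE) auto
qed

definition Lp :: "real \<Rightarrow> L0 set" where
  "Lp p = {f. Lp_mem p f}"

lift_definition Lp_norm :: "real \<Rightarrow> L0 \<Rightarrow> real" is
  "\<lambda>p f. (\<integral>t. \<bar>f t\<bar> powr p \<partial>lebesgue_on {0..1}) powr (1 / p)"
proof -
  fix p :: real and f g :: "real \<Rightarrow> real"
  assume "ae_eq f g"
  then have [measurable]: "f \<in> borel_measurable (lebesgue_on {0..1})"
      "g \<in> borel_measurable (lebesgue_on {0..1})"
    and "AE t in lebesgue_on {0..1}. f t = g t"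
    by (auto simp: ae_eq_def)
  then have "(\<integral>t. \<bar>f t\<bar> powr p \<partial>lebesgue_on {0..1}) = (\<integral>t. \<bar>g t\<bar> powr p \<partial>lebesgue_on {0..1})"
    by (intro integral_cong_AE) auto
  then show "(\<integral>t. \<bar>f t\<bar> powr p \<partial>lebesgue_on {0..1}) powr (1 / p) =
      (\<integral>t. \<bar>g t\<bar> powr p \<partial>lebesgue_on {0..1}) powr (1 / p)"
    by simp
qed

lemma subspace_Lp:
  assumes "p > 0"
  shows "subspace (Lp p)"
proof (rule subspaceI)
  show "0 \<in> Lp p"
    unfolding Lp_def mem_Collect_eq by transfer simp
next
  fix x y assume "x \<in> Lp p" "y \<in> Lp p"
  then show "x + y \<in> Lp p"
    unfolding Lp_def mem_Collect_eq
  proof (transfer fixing: p)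
    fix f g :: "real \<Rightarrow> real"
    assume fg: "ae_eq f f" "ae_eq g g"
      and int: "integrable (lebesgue_on {0..1}) (\<lambda>t. \<bar>f t\<bar> powr p)"
        "integrable (lebesgue_on {0..1}) (\<lambda>t. \<bar>g t\<bar> powr p)"
    have [measurable]: "f \<in> borel_measurable (lebesgue_on {0..1})"
      "g \<in> borel_measurable (lebesgue_on {0..1})"
      using fg by (simp_all add: ae_eq_refl_iff)
    have bound: "\<bar>a + b\<bar> powr p \<le> 2 powr p * (\<bar>a\<bar> powr p + \<bar>b\<bar> powr p)" for a b :: real
    proof -
      have "\<bar>a + b\<bar> powr p \<le> (2 * max \<bar>a\<bar> \<bar>b\<bar>) powr p"
        using assms by (intro powr_mono2) auto
      also have "\<dots> = 2 powr p * max \<bar>a\<bar> \<bar>b\<bar> powr p"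
        by (simp add: powr_mult)
      also have "\<dots> \<le> 2 powr p * (\<bar>a\<bar> powr p + \<bar>b\<bar> powr p)"
        by (intro mult_left_mono) (auto simp: max_def)
      finally show ?thesis .
    qed
    show "integrable (lebesgue_on {0..1}) (\<lambda>t. \<bar>f t + g t\<bar> powr p)"
      by (rule Bochner_Integration.integrable_bound
          [of _ "\<lambda>t. 2 powr p * (\<bar>f t\<bar> powr p + \<bar>g t\<bar> powr p)"])
        (use int bound in \<open>auto intro!: AE_I2\<close>)
  qed
next
  fix c x assume "x \<in> Lp p"
  then show "c *\<^sub>R x \<in> Lp p"
    unfolding Lp_def mem_Collect_eq by (transfer fixing: p) (simp add: abs_mult powr_mult)
qed

definition dyadic_haar :: "nat \<Rightarrow> nat \<Rightarrow> real \<Rightarrow> real" where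
  "dyadic_haar k j t =
     (if t \<in> {(2 * real j - 2) / 2 ^ (k + 1) .. (2 * real j - 1) / 2 ^ (k + 1)} then 1
      else if t \<in> {(2 * real j - 1) / 2 ^ (k + 1) <.. 2 * real j / 2 ^ (k + 1)} then - 1
      else 0)"

(* Every n >= 2 is uniquely 2^k + j with 1 <= j <= 2^k, namely for k = floor_log (n - 1).
   The index 0 is never used: the Haar system starts at n = 1. *)
definition haar_fun :: "nat \<Rightarrow> real \<Rightarrow> real" where
  "haar_fun n t =
     (if n \<le> 1 then 1
      else dyadic_haar (floor_log (n - 1)) (n - 2 ^ floor_log (n - 1)) t)"

lemma haar_fun_1: "haar_fun 1 t = 1"
  by (simp add: haar_fun_def)

lemma haar_fun_dyadic:
  assumes "1 \<le> j" "j \<le> 2 ^ k"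
  shows "haar_fun (2 ^ k + j) t = dyadic_haar k j t"
proof -
  have "floor_log (2 ^ k + j - 1) = k"
    by (rule floor_log_eqI) (use assms in auto)
  moreover have "(2 :: nat) ^ k \<ge> 1"
    by simp
  then have "\<not> 2 ^ k + j \<le> 1"
    using assms by linarith
  ultimately show ?thesis
    by (simp add: haar_fun_def)
qed

lemma dyadic_haar_borel_measurable: "dyadic_haar k j \<in> borel_measurable borel"
  unfolding dyadic_haar_def[abs_def] by (intro measurable_If measurable_const) auto

lemma haar_fun_borel_measurable: "haar_fun n \<in> borel_measurable borel"
  by (cases "n \<le> 1") (simp_all add: haar_fun_def[abs_def] dyadic_haar_borel_measurable)

lemma haar_fun_measurable: "haar_fun n \<in> borel_measurable (lebesgue_on {0..1})"
  by (rule measurable_restrict_space1, rule measurable_completion)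
    (simp add: haar_fun_borel_measurable)

lift_definition haar :: "nat \<Rightarrow> L0" is haar_fun
  by (simp add: ae_eq_refl_iff haar_fun_measurable)

lemma haar_in_Lp: "haar n \<in> Lp p"
  unfolding Lp_def mem_Collect_eq
proof transfer
  fix n :: nat and p :: real
  interpret finite_measure "lebesgue_on {0..1::real}"
    by (rule finite_measure_lebesgue_on) auto
  have le_1: "\<bar>haar_fun n t\<bar> powr p \<le> 1" for t
    by (simp add: haar_fun_def dyadic_haar_def)
  show "integrable (lebesgue_on {0..1}) (\<lambda>t. \<bar>haar_fun n t\<bar> powr p)"
  proof (rule integrable_const_bound[where B = 1])
    show "AE t in lebesgue_on {0..1}. norm (\<bar>haar_fun n t\<bar> powr p) \<le> 1"
      by (rule AE_I2) (simp add: le_1)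
    show "(\<lambda>t. \<bar>haar_fun n t\<bar> powr p) \<in> borel_measurable (lebesgue_on {0..1})"
      using haar_fun_measurable[of n] by simp
  qed
qed

(* The series converges in the L_p norm. *)
definition haar_cone :: "real \<Rightarrow> L0 set" where
  "haar_cone p =
     {x \<in> Lp p. \<exists>a :: nat \<Rightarrow> real. (\<forall>n\<ge>1. a n \<ge> 0) \<and>
        (\<lambda>N. Lp_norm p (x - (\<Sum>n = 1..N. a n *\<^sub>R haar n))) \<longlonglongrightarrow> 0}"

(* In the following, a normed space is a linear subspace V of a real vector space together with a
   function nm that is a norm on V.  Functionals on V are total functions of which only the values
   on V matter. *)

definition dual_space :: "'a::real_vector set \<Rightarrow> ('a \<Rightarrow> real) \<Rightarrow> ('a \<Rightarrow> real) set" where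
  "dual_space V nm =
     {\<phi>. (\<forall>x\<in>V. \<forall>y\<in>V. \<phi> (x + y) = \<phi> x + \<phi> y) \<and>
         (\<forall>c. \<forall>x\<in>V. \<phi> (c *\<^sub>R x) = c * \<phi> x) \<and>
         (\<exists>K. \<forall>x\<in>V. \<bar>\<phi> x\<bar> \<le> K * nm x)}"

definition support_point ::
    "'a::real_vector set \<Rightarrow> ('a \<Rightarrow> real) \<Rightarrow> 'a set \<Rightarrow> 'a \<Rightarrow> bool" where
  "support_point V nm C x \<longleftrightarrow>
     x \<in> C \<and> (\<exists>\<phi>\<in>dual_space V nm. (\<exists>v\<in>V. \<phi> v \<noteq> 0) \<and> (\<forall>y\<in>C. \<phi> y \<le> \<phi> x))"

definition nonsupport_points ::
    "'a::real_vector set \<Rightarrow> ('a \<Rightarrow> real) \<Rightarrow> 'a set \<Rightarrow> 'a set" where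
  "nonsupport_points V nm C = {x \<in> C. \<not> support_point V nm C x}"

definition generated_cone :: "'a::real_vector set \<Rightarrow> 'a \<Rightarrow> 'a set" where
  "generated_cone C u = {l *\<^sub>R (c - u) | l c. l > 0 \<and> c \<in> C}"

definition unit_space :: "'a::real_vector set \<Rightarrow> 'a \<Rightarrow> 'a set" where
  "unit_space C u = generated_cone C u \<inter> uminus ` generated_cone C u"

definition cone_le :: "'a::real_vector set \<Rightarrow> 'a \<Rightarrow> 'a \<Rightarrow> bool" where
  "cone_le C x y \<longleftrightarrow> y - x \<in> C"

definition sym_interval :: "'a::real_vector set \<Rightarrow> 'a set \<Rightarrow> 'a \<Rightarrow> 'a set" where
  "sym_interval V C u = {x \<in> V. cone_le C (- u) x \<and> cone_le C x u}"

definition unit_norm :: "'a::real_vector set \<Rightarrow> 'a set \<Rightarrow> 'a \<Rightarrow> 'a \<Rightarrow> real" where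
  "unit_norm V C u x = Inf {l. l > 0 \<and> x \<in> (\<lambda>y. l *\<^sub>R y) ` sym_interval V C u}"

definition linearly_isometric ::
    "'a::real_vector set \<Rightarrow> ('a \<Rightarrow> real) \<Rightarrow> 'b::real_vector set \<Rightarrow> ('b \<Rightarrow> real) \<Rightarrow> bool" where
  "linearly_isometric V nV W nW \<longleftrightarrow>
     subspace V \<and> subspace W \<and>
     (\<exists>T. bij_betw T V W \<and>
          (\<forall>x\<in>V. \<forall>y\<in>V. T (x + y) = T x + T y) \<and>
          (\<forall>c. \<forall>x\<in>V. T (c *\<^sub>R x) = c *\<^sub>R T x) \<and>
          (\<forall>x\<in>V. nW (T x) = nV x))"

(* nat carries the discrete topology, so these are all bounded real sequences, and the norm of the
   library type is the supremum norm. *)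
type_synonym l_infinity = "nat \<Rightarrow>\<^sub>C real"

end

theory Submission
  imports Defs
begin

text \<open>A point \<open>u\<close> of the cone with a vanishing \<open>n\<close>-th Haar coefficient is supported by minus the
  \<open>n\<close>-th coefficient functional, so all coefficients of a nonsupport point are positive. Then
  \<open>x\<close> lies in \<open>l [-u, u]\<close> iff \<open>x\<close> has a Haar expansion with \<open>\<bar>x\<^sub>n\<bar> \<le> l u\<^sub>n\<close> for all \<open>n\<close>, and
  \<open>x \<mapsto> (x\<^sub>n / u\<^sub>n)\<close> is isometric; it is onto \<open>l_infinity\<close> because the Haar system is
  unconditional. Unconditionality follows from Burkholder's method: a function \<open>W\<close> that is
  zigzag concave, at most \<open>0\<close> where \<open>\<bar>g\<bar> \<le> \<bar>f\<bar>\<close>, and bounds \<open>\<bar>g\<bar> powr p - K \<bar>f\<bar> powr p\<close> from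
  above up to a factor has \<open>\<integral>W(f, g) \<le> 0\<close> for a Haar sum \<open>f\<close> and its sign transform \<open>g\<close>,
  because adding one Haar function to the sums never increases the integral.\<close>

section \<open>A zigzag concave function\<close>

text \<open>The hard point is surjectivity: for a bounded sequence \<open>g\<close> the series with
  coefficients \<open>g n\<close> times those of \<open>u\<close> has to converge in L_p. This needs
  a bound, uniform in the length of a finite Haar sum, for multiplying its coefficients by numbers
  in [-1, 1]. Applied to tails, it carries the Cauchy property over from the series of
  \<open>u\<close> to the new one. Signs come first because every such multiplier is a convex
  combination of signs. The number \<open>2 * e\<close> in the zigzag concave function stands for
  Burkholder's constant max(p, p/(p-1)). Every larger value serves as well, since only finiteness of
  the resulting bound matters. Sizes are measured by p-th powers, with |a + b|^p \<le> 2^p (|a|^p +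
  |b|^p) as the triangle inequality. The cone, and with it X_u, consists of sums of their own Haar
  series. The order argument therefore takes place in the subspace of such sums, where the
  coefficients determine the element.\<close>

lemma convex_on_abs_powr:
  fixes p :: real
  assumes "1 \<le> p"
  shows "convex_on UNIV (\<lambda>x::real. \<bar>x\<bar> powr p)"
proof (rule convex_onI)
  fix t x y :: real
  assume t: "0 < t" "t < 1"
  have pos: "((1 - t) * a + t * b) powr p \<le> (1 - t) * a powr p + t * b powr p"
    if ab: "0 \<le> a" "0 \<le> b" for a b
  proof -
    \<comment> \<open>If one endpoint is \<open>0\<close>, the inequality reduces to this estimate
      for the weight of the other one.\<close>
    have small: "s powr p \<le> s" if "0 < s" "s < 1" for s :: real
      using powr_mono'[of 1 p s] assms that by simp
    consider "a = 0" | "b = 0" | "0 < a" "0 < b"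
      using ab by linarith
    then show ?thesis
    proof cases
      case 1
      then show ?thesis
        using small[OF t] ab by (simp add: powr_mult mult_right_mono)
    next
      case 2
      then show ?thesis
        using small[of "1 - t"] t ab by (simp add: powr_mult mult_right_mono)
    next
      case 3
      then show ?thesis
        using convex_onD[OF powr_convex[OF assms], of t a b] t by simp
    qed
  qed
  have "\<bar>(1 - t) *\<^sub>R x + t *\<^sub>R y\<bar> \<le> (1 - t) * \<bar>x\<bar> + t * \<bar>y\<bar>"
    using t abs_triangle_ineq[of "(1 - t) * x" "t * y"] by (simp add: abs_mult)
  then have "\<bar>(1 - t) *\<^sub>R x + t *\<^sub>R y\<bar> powr p \<le> ((1 - t) * \<bar>x\<bar> + t * \<bar>y\<bar>) powr p"
    using assms by (intro powr_mono2) auto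
  also have "\<dots> \<le> (1 - t) * \<bar>x\<bar> powr p + t * \<bar>y\<bar> powr p"
    by (rule pos) auto
  finally show "\<bar>(1 - t) *\<^sub>R x + t *\<^sub>R y\<bar> powr p \<le> (1 - t) * \<bar>x\<bar> powr p + t * \<bar>y\<bar> powr p" .
qed auto

text \<open>The line rules out a concave kink at \<open>a\<close>: it puts the point of the graph
  over \<open>a\<close> below every chord that spans \<open>a\<close>. A point between
  \<open>x\<close> and \<open>a\<close> lies below the chord from \<open>x\<close> to
  \<open>a\<close> by convexity on the left, hence below the chord from \<open>x\<close> to
  \<open>y\<close>; the other side is symmetric.\<close>

lemma convex_on_real_glue:
  fixes f :: "real \<Rightarrow> real"
  assumes "convex S" "a \<in> S"
    and left: "convex_on (S \<inter> {..a}) f" and right: "convex_on (S \<inter> {a..}) f"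
    and tangent: "\<And>x. x \<in> S \<Longrightarrow> f a + m * (x - a) \<le> f x"
  shows "convex_on S f"
proof (rule convex_on_linorderI)
  fix t x y :: real
  assume t: "0 < t" "t < 1" and S: "x \<in> S" "y \<in> S" and "x < y"
  define z where "z = (1 - t) *\<^sub>R x + t *\<^sub>R y"
  have zx: "z - x = t * (y - x)" and yz: "y - z = (1 - t) * (y - x)"
    by (simp_all add: z_def algebra_simps)
  have "x < z" "z < y"
    using t \<open>x < y\<close> zx yz by (smt (verit) mult_pos_pos)+
  show "f ((1 - t) *\<^sub>R x + t *\<^sub>R y) \<le> (1 - t) * f x + t * f y"
  proof -
    consider "y \<le> a" | "a \<le> x" | "x < a" "a < y"
      by linarith
    then show ?thesis
    proof cases
      case 1
      then show ?thesis
        using convex_onD[OF left, of t x y] t S \<open>x < y\<close> by auto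
    next
      case 2
      then show ?thesis
        using convex_onD[OF right, of t x y] t S \<open>x < y\<close> by auto
    next
      case 3
      define r where "r = (a - x) / (y - x)"
      have r: "0 < r" "r < 1" "a - x = r * (y - x)" "y - a = (1 - r) * (y - x)"
        using 3 by (auto simp: r_def field_simps)
      have "f a = (1 - r) * (f a + m * (x - a)) + r * (f a + m * (y - a))"
      proof -
        have "(1 - r) * (x - a) + r * (y - a) = 0"
          using r(3,4) by (metis (no_types) add.commute diff_add_cancel diff_minus_eq_add
              minus_diff_eq mult.left_commute mult_minus_right right_minus_eq)
        then have "m * ((1 - r) * (x - a) + r * (y - a)) = 0"
          by simp
        then show ?thesis
          by (simp add: algebra_simps)
      qed
      also have "\<dots> \<le> (1 - r) * f x + r * f y"
        using r tangent[OF S(1)] tangent[OF S(2)] by (intro add_mono mult_left_mono) auto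
      finally have fa: "f a \<le> (1 - r) * f x + r * f y" .
      show ?thesis
      proof (cases "z \<le> a")
        case True
        \<comment> \<open>Measured along the segment from \<open>x\<close> to \<open>y\<close>,
          \<open>z\<close> sits at \<open>t\<close> and \<open>a\<close> at \<open>r\<close>. So
          \<open>z\<close> sits at \<open>t / r\<close> on the segment from \<open>x\<close> to
          \<open>a\<close>.\<close>
        define s where "s = t / r"
        have "t \<le> r"
        proof -
          have "t * (y - x) \<le> r * (y - x)"
            using True zx r(3) by linarith
          then show ?thesis
            using \<open>x < y\<close> by simp
        qed
        then have s: "0 \<le> s" "s \<le> 1" "s * r = t"
          using r t by (auto simp: s_def field_simps)
        have za: "z = (1 - s) *\<^sub>R x + s *\<^sub>R a"
        proof -
          have "s * (a - x) = t * (y - x)"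
            using r(3) s(3) by simp
          then show ?thesis
            using zx by (simp add: algebra_simps)
        qed
        have "f z \<le> (1 - s) * f x + s * f a"
          unfolding za using convex_onD[OF left, of s x a] s S \<open>a \<in> S\<close> 3 by auto
        also have "\<dots> \<le> (1 - s) * f x + s * ((1 - r) * f x + r * f y)"
          using fa s by (intro add_left_mono mult_left_mono) auto
        also have "\<dots> = (1 - s * r) * f x + (s * r) * f y"
          by (simp add: algebra_simps)
        finally show ?thesis
          using s by (simp add: z_def)
      next
        case False
        define s where "s = (1 - t) / (1 - r)"
        have "1 - t \<le> 1 - r"
        proof -
          have "(1 - t) * (y - x) \<le> (1 - r) * (y - x)"
            using False yz r(4) by linarith
          then show ?thesis
            using \<open>x < y\<close> by simp
        qed
        then have s: "0 \<le> s" "s \<le> 1" "s * (1 - r) = 1 - t"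
          using r t by (auto simp: s_def field_simps)
        have za: "z = (1 - (1 - s)) *\<^sub>R a + (1 - s) *\<^sub>R y"
        proof -
          have "s * (y - a) = (1 - t) * (y - x)"
            using r(4) s(3) by simp
          then show ?thesis
            using yz by (simp add: algebra_simps)
        qed
        have "f z \<le> s * f a + (1 - s) * f y"
          unfolding za using convex_onD[OF right, of "1 - s" a y] s S \<open>a \<in> S\<close> 3 by auto
        also have "\<dots> \<le> s * ((1 - r) * f x + r * f y) + (1 - s) * f y"
          using fa s by (intro add_right_mono mult_left_mono) auto
        also have "\<dots> = (s * (1 - r)) * f x + (1 - s * (1 - r)) * f y"
          by (simp add: algebra_simps)
        finally show ?thesis
          using s by (simp add: z_def)
      qed
    qed
  qed
qed fact

text \<open>Burkholder's function for the pair \<open>f = \<alpha> + \<beta>\<close>, \<open>g = \<alpha> - \<beta>\<close>: up to constants it is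
  \<open>(\<bar>f\<bar> + \<bar>g\<bar>) powr p - 2 * e * \<bar>f\<bar> * (\<bar>f\<bar> + \<bar>g\<bar>) powr (p - 1)\<close>. In these coordinates a common step
  of \<open>f\<close> and \<open>g\<close> by \<open>(h, \<plusminus>h)\<close> moves only one of \<open>\<alpha>\<close>, \<open>\<beta>\<close>, so separate concavity suffices.\<close>

definition burkholder :: "real \<Rightarrow> real \<Rightarrow> real \<Rightarrow> real \<Rightarrow> real" where
  "burkholder p e \<alpha> \<beta> =
     max \<bar>\<alpha>\<bar> \<bar>\<beta>\<bar> powr p - e * \<bar>\<alpha> + \<beta>\<bar> * max \<bar>\<alpha>\<bar> \<bar>\<beta>\<bar> powr (p - 1)"

lemma burkholder_commute: "burkholder p e \<alpha> \<beta> = burkholder p e \<beta> \<alpha>"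
  by (simp add: burkholder_def max.commute add.commute)

lemma burkholder_uminus: "burkholder p e (- \<alpha>) (- \<beta>) = burkholder p e \<alpha> \<beta>"
proof -
  have "\<bar>- \<alpha> + - \<beta>\<bar> = \<bar>\<alpha> + \<beta>\<bar>"
    by linarith
  then show ?thesis
    by (simp only: burkholder_def abs_minus_cancel)
qed

text \<open>The second derivative is (p-1) x^(p-3) (A p x + B (p-2)). As \<open>A\<close> is
  nonnegative the bracket grows with \<open>x\<close>, so its sign at \<open>b\<close> decides. The
  lemma serves \<open>A = e - 1\<close> and \<open>B = e * \<beta>\<close> or
  \<open>- e * \<beta>\<close>, the outer branches of the negated Burkholder function.\<close>

lemma powr_combination_convex:
  fixes p A B b :: real
  assumes "0 < b" "1 < p" "0 \<le> A" "0 \<le> A * p * b + B * (p - 2)"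
  shows "convex_on {b..} (\<lambda>x. A * x powr p + B * x powr (p - 1))" (is "convex_on _ ?f")
    and "\<And>x. b \<le> x \<Longrightarrow>
      A * b powr p + B * b powr (p - 1) +
        (A * (p * b powr (p - 1)) + B * ((p - 1) * b powr (p - 2))) * (x - b)
      \<le> A * x powr p + B * x powr (p - 1)"
proof -
  let ?f' = "\<lambda>x. A * (p * x powr (p - 1)) + B * ((p - 1) * x powr (p - 2))"
  let ?f'' = "\<lambda>x. A * (p * ((p - 1) * x powr (p - 2))) + B * ((p - 1) * ((p - 2) * x powr (p - 3)))"
  have f': "(?f has_real_derivative ?f' x) (at x)" if "x \<in> {b..}" for x
    using that assms by (auto intro!: derivative_eq_intros simp: algebra_simps)
  have f'': "(?f' has_real_derivative ?f'' x) (at x)" if "x \<in> {b..}" for x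
    using that assms by (auto intro!: derivative_eq_intros simp: algebra_simps)
  have nonneg: "0 \<le> ?f'' x" if "x \<in> {b..}" for x
  proof -
    have x: "b \<le> x" "0 < x" using assms that by auto
    have "x powr (p - 2) = x powr (p - 3) * x"
      using x powr_add[of x "p - 3" 1] by simp
    then have eq: "?f'' x = (p - 1) * x powr (p - 3) * (A * p * x + B * (p - 2))"
      by (simp add: algebra_simps)
    have "A * p * b \<le> A * p * x"
      using assms x by (intro mult_left_mono) auto
    then have "0 \<le> (p - 1) * x powr (p - 3) * (A * p * x + B * (p - 2))"
      using assms by (intro mult_nonneg_nonneg) auto
    then show ?thesis
      by (simp only: eq)
  qed
  show "convex_on {b..} ?f"
    using f''_ge0_imp_convex[of "{b..}" ?f ?f' ?f''] f' f'' nonneg by auto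
  show "?f b + ?f' b * (x - b) \<le> ?f x" if "b \<le> x" for x
    using f''_imp_f'[of "{b..}" ?f ?f' ?f'' b x] f' f'' nonneg that
    by (auto simp: algebra_simps)
qed

text \<open>Each hypothesis on \<open>e\<close> has its own source: \<open>1 \<le> e\<close> makes
  the leading coefficient of the outer branches nonnegative, \<open>p \<le> 2 * e\<close> is the
  convexity condition of the left branch at its endpoint, and \<open>p \<le> 2 * e * (p - 1)\<close>
  that of the right branch.\<close>

lemma convex_on_minus_burkholder:
  assumes p: "1 < p" and e: "1 \<le> e" "p \<le> 2 * e" "p \<le> 2 * e * (p - 1)" and "0 < \<beta>"
  shows "convex_on UNIV (\<lambda>\<alpha>. - burkholder p e \<alpha> \<beta>)"
proof -
  define f where "f = (\<lambda>\<alpha>. - burkholder p e \<alpha> \<beta>)"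
  \<comment> \<open>\<open>f\<close> is the line \<open>g\<close> on \<open>[-\<beta>, \<beta>]\<close> and convex on either side; it is convex across \<open>\<plusminus>\<beta>\<close>
    because it stays above \<open>g\<close>.\<close>
  define g where "g = (\<lambda>\<alpha>. e * (\<alpha> + \<beta>) * \<beta> powr (p - 1) - \<beta> powr p)"
  have powr_1: "x * x powr (p - 1) = x powr p" if "0 < x" for x
    using that by (simp add: powr_diff)
  have powr_2: "x * x powr (p - 2) = x powr (p - 1)" if "0 < x" for x
    using that powr_add[of x 1 "p - 2"] by simp
  have right_cond: "0 \<le> (e - 1) * p * \<beta> + e * \<beta> * (p - 2)"
  proof -
    have "(e - 1) * p * \<beta> + e * \<beta> * (p - 2) = (2 * e * (p - 1) - p) * \<beta>"
      by (simp add: algebra_simps)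
    then show ?thesis
      using e \<open>0 < \<beta>\<close> by simp
  qed
  have left_cond: "0 \<le> (e - 1) * p * \<beta> + - e * \<beta> * (p - 2)"
  proof -
    have "(e - 1) * p * \<beta> + - e * \<beta> * (p - 2) = (2 * e - p) * \<beta>"
      by (simp add: algebra_simps)
    then show ?thesis
      using e \<open>0 < \<beta>\<close> by simp
  qed
  have f_right: "f x = (e - 1) * x powr p + e * \<beta> * x powr (p - 1)" if "\<beta> \<le> x" for x
    using that \<open>0 < \<beta>\<close> powr_1[of x] by (simp add: f_def burkholder_def algebra_simps)
  have f_left: "f x = (e - 1) * (- x) powr p + - e * \<beta> * (- x) powr (p - 1)" if "x \<le> - \<beta>" for x
  proof -
    have *: "x * (- x) powr (p - 1) = - ((- x) powr p)"
      using powr_1[of "- x"] that \<open>0 < \<beta>\<close> by simp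
    have "max \<bar>x\<bar> \<bar>\<beta>\<bar> = - x" "\<bar>x + \<beta>\<bar> = - x - \<beta>"
      using that \<open>0 < \<beta>\<close> by auto
    then show ?thesis
      by (simp add: f_def burkholder_def left_diff_distrib right_diff_distrib mult.assoc *)
  qed
  have f_mid: "f x = g x" if "- \<beta> \<le> x" "x \<le> \<beta>" for x
  proof -
    have "max \<bar>x\<bar> \<bar>\<beta>\<bar> = \<beta>" "\<bar>x + \<beta>\<bar> = x + \<beta>"
      using that by auto
    then show ?thesis
      by (simp add: f_def g_def burkholder_def)
  qed
  have g_right: "g x \<le> f x" if "\<beta> \<le> x" for x
  proof -
    \<comment> \<open>The slope of the line is at most the right derivative of \<open>f\<close> at
      \<open>\<beta>\<close>. After cancelling the power this is
      \<open>p \<le> 2 * e * (p - 1)\<close> once more.\<close>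
    have "e * \<beta> powr (p - 1) \<le> ((e - 1) * p + e * (p - 1)) * \<beta> powr (p - 1)"
      using e by (intro mult_right_mono) (auto simp: algebra_simps)
    also have "\<dots> = (e - 1) * (p * \<beta> powr (p - 1)) + e * \<beta> * ((p - 1) * \<beta> powr (p - 2))"
      unfolding powr_2[OF \<open>0 < \<beta>\<close>, symmetric] by (simp add: algebra_simps)
    finally have "e * \<beta> powr (p - 1) * (x - \<beta>) \<le>
        ((e - 1) * (p * \<beta> powr (p - 1)) + e * \<beta> * ((p - 1) * \<beta> powr (p - 2))) * (x - \<beta>)"
      using that by (intro mult_right_mono) auto
    moreover have "g x = (e - 1) * \<beta> powr p + e * \<beta> * \<beta> powr (p - 1) + e * \<beta> powr (p - 1) * (x - \<beta>)"
      using powr_1[of \<beta>] \<open>0 < \<beta>\<close> by (simp add: g_def algebra_simps)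
    ultimately show ?thesis
      using powr_combination_convex(2)[OF \<open>0 < \<beta>\<close> p _ right_cond, of x] e that
      by (simp add: f_right)
  qed
  have g_left: "g x \<le> f x" if "x \<le> - \<beta>" for x
  proof -
    \<comment> \<open>The same slope comparison in the reflected variable \<open>- x\<close>, where
      the line has the opposite slope. It amounts to \<open>p \<le> 2 * e\<close>.\<close>
    have "- e * \<beta> powr (p - 1) \<le> ((e - 1) * p + - e * (p - 1)) * \<beta> powr (p - 1)"
      using e by (intro mult_right_mono) (auto simp: algebra_simps)
    also have "\<dots> = (e - 1) * (p * \<beta> powr (p - 1)) + - e * \<beta> * ((p - 1) * \<beta> powr (p - 2))"
      unfolding powr_2[OF \<open>0 < \<beta>\<close>, symmetric] by (simp add: algebra_simps)
    finally have "- e * \<beta> powr (p - 1) * (- x - \<beta>) \<le>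
        ((e - 1) * (p * \<beta> powr (p - 1)) + - e * \<beta> * ((p - 1) * \<beta> powr (p - 2))) * (- x - \<beta>)"
      using that by (intro mult_right_mono) auto
    moreover have "g x = (e - 1) * \<beta> powr p + - e * \<beta> * \<beta> powr (p - 1) + - e * \<beta> powr (p - 1) * (- x - \<beta>)"
      using powr_1[of \<beta>] \<open>0 < \<beta>\<close> by (simp add: g_def algebra_simps)
    ultimately show ?thesis
      using powr_combination_convex(2)[OF \<open>0 < \<beta>\<close> p _ left_cond, of "- x"] e that
      by (simp add: f_left)
  qed
  have g_le: "g x \<le> f x" for x
    using g_right g_left f_mid[of x] by (cases "x \<le> - \<beta>"; cases "\<beta> \<le> x") auto
  have g_tangent: "g a + e * \<beta> powr (p - 1) * (x - a) = g x" for a x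
    by (simp add: g_def algebra_simps)
  have right: "convex_on {\<beta>..} f"
  proof (rule convex_onI)
    fix t x y :: real
    assume t: "0 < t" "t < 1" and xy: "x \<in> {\<beta>..}" "y \<in> {\<beta>..}"
    have mem: "(1 - t) *\<^sub>R x + t *\<^sub>R y \<in> {\<beta>..}"
      using t xy by (intro convexD) auto
    show "f ((1 - t) *\<^sub>R x + t *\<^sub>R y) \<le> (1 - t) * f x + t * f y"
      using convex_onD[OF powr_combination_convex(1)[OF \<open>0 < \<beta>\<close> p _ right_cond], of t x y]
        t xy e mem
      by (simp only: f_right atLeast_iff)
  qed auto
  have left: "convex_on {..- \<beta>} f"
  proof (rule convex_onI)
    fix t x y :: real
    assume t: "0 < t" "t < 1" and xy: "x \<in> {..- \<beta>}" "y \<in> {..- \<beta>}"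
    have mem: "(1 - t) *\<^sub>R x + t *\<^sub>R y \<in> {..- \<beta>}"
      using t xy by (intro convexD) auto
    let ?h = "\<lambda>x. (e - 1) * x powr p + - e * \<beta> * x powr (p - 1)"
    have "?h ((1 - t) *\<^sub>R (- x) + t *\<^sub>R (- y)) \<le> (1 - t) * ?h (- x) + t * ?h (- y)"
      using t xy e
      by (intro convex_onD[OF powr_combination_convex(1)[OF \<open>0 < \<beta>\<close> p _ left_cond]]) auto
    moreover have "(1 - t) *\<^sub>R (- x) + t *\<^sub>R (- y) = - ((1 - t) *\<^sub>R x + t *\<^sub>R y)"
      by simp
    ultimately show "f ((1 - t) *\<^sub>R x + t *\<^sub>R y) \<le> (1 - t) * f x + t * f y"
      using mem xy by (simp only: f_left atMost_iff)
  qed auto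
  have mid: "convex_on {- \<beta>..\<beta>} f"
  proof (rule convex_onI)
    fix t x y :: real
    assume t: "0 < t" "t < 1" and xy: "x \<in> {- \<beta>..\<beta>}" "y \<in> {- \<beta>..\<beta>}"
    have mem: "(1 - t) *\<^sub>R x + t *\<^sub>R y \<in> {- \<beta>..\<beta>}"
      using t xy by (intro convexD) auto
    have "g ((1 - t) *\<^sub>R x + t *\<^sub>R y) = (1 - t) * g x + t * g y"
      by (simp add: g_def algebra_simps)
    then show "f ((1 - t) *\<^sub>R x + t *\<^sub>R y) \<le> (1 - t) * f x + t * f y"
      using mem xy by (simp add: f_mid)
  qed auto
  have glued: "convex_on {- \<beta>..} f"
  proof (rule convex_on_real_glue[of _ \<beta> _ "e * \<beta> powr (p - 1)"])
    have "{- \<beta>..} \<inter> {..\<beta>} = {- \<beta>..\<beta>}" "{- \<beta>..} \<inter> {\<beta>..} = {\<beta>..}"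
      using \<open>0 < \<beta>\<close> by auto
    then show "convex_on ({- \<beta>..} \<inter> {..\<beta>}) f" "convex_on ({- \<beta>..} \<inter> {\<beta>..}) f"
      using mid right by simp_all
    show "f \<beta> + e * \<beta> powr (p - 1) * (x - \<beta>) \<le> f x" for x
      using g_le[of x] f_mid[of \<beta>] g_tangent[of \<beta> x] \<open>0 < \<beta>\<close> by simp
  qed (use \<open>0 < \<beta>\<close> in auto)
  have "convex_on UNIV f"
  proof (rule convex_on_real_glue[of _ "- \<beta>" _ "e * \<beta> powr (p - 1)"])
    show "f (- \<beta>) + e * \<beta> powr (p - 1) * (x - - \<beta>) \<le> f x" for x
      using g_le[of x] f_mid[of "- \<beta>"] g_tangent[of "- \<beta>" x] \<open>0 < \<beta>\<close> by simp
  qed (use left glued in auto)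
  then show ?thesis
    by (simp add: f_def)
qed

text \<open>A Haar function takes the values 1 and -1 on halves of equal length, so concavity is
  needed only at midpoints. For \<open>\<beta> = 0\<close> the function is a nonpositive multiple of
  |x|^p, and negative \<open>\<beta>\<close> reduces to positive by symmetry under a common change
  of sign.\<close>

lemma burkholder_midpoint:
  assumes p: "1 < p" and e: "1 \<le> e" "p \<le> 2 * e" "p \<le> 2 * e * (p - 1)"
  shows "burkholder p e (\<alpha> + \<delta>) \<beta> + burkholder p e (\<alpha> - \<delta>) \<beta> \<le> 2 * burkholder p e \<alpha> \<beta>"
proof -
  have midpoint: "f (a + d) + f (a - d) \<ge> 2 * f a" if "convex_on UNIV f" for f :: "real \<Rightarrow> real" and a d
    using convex_onD[OF that, of "1/2" "a + d" "a - d"] by (simp add: field_simps)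
  have pos: "burkholder p e (\<alpha> + \<delta>) \<beta> + burkholder p e (\<alpha> - \<delta>) \<beta> \<le> 2 * burkholder p e \<alpha> \<beta>"
    if "0 < \<beta>" for \<alpha> \<beta> \<delta>
    using midpoint[OF convex_on_minus_burkholder[OF p e that], of \<alpha> \<delta>] by simp
  consider "0 < \<beta>" | "\<beta> = 0" | "\<beta> < 0" by linarith
  then show ?thesis
  proof cases
    case 1
    then show ?thesis by (rule pos)
  next
    case 2
    have "burkholder p e x 0 = (1 - e) * \<bar>x\<bar> powr p" for x
    proof (cases "x = 0")
      case False
      then show ?thesis
        using powr_mult_base[of "\<bar>x\<bar>" "p - 1"] by (simp add: burkholder_def algebra_simps)
    qed (simp add: burkholder_def)
    then have eq: "burkholder p e x 0 = - ((e - 1) * \<bar>x\<bar> powr p)" for x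
      by (simp add: algebra_simps)
    have "(e - 1) * (2 * \<bar>\<alpha>\<bar> powr p) \<le> (e - 1) * (\<bar>\<alpha> + \<delta>\<bar> powr p + \<bar>\<alpha> - \<delta>\<bar> powr p)"
      using midpoint[OF convex_on_abs_powr[of p], of \<alpha> \<delta>] p e by (intro mult_left_mono) auto
    then show ?thesis
      unfolding 2 eq by (simp add: distrib_left)
  next
    case 3
    have "burkholder p e x \<beta> = burkholder p e (- x) (- \<beta>)" for x
      by (simp only: burkholder_uminus)
    then show ?thesis
      using pos[of "- \<beta>" "- \<alpha>" "- \<delta>"] 3 by simp
  qed
qed

text \<open>The hypothesis on the product says \<bar>\<alpha> - \<beta>\<bar> \<le> \<bar>\<alpha> +
  \<beta>\<bar>. For equal signs the maximum is at most \<bar>\<alpha> + \<beta>\<bar>, so one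
  factor of its p-th power is absorbed by the subtracted term.\<close>

lemma burkholder_nonpos:
  assumes "0 \<le> \<alpha> * \<beta>" "1 \<le> e"
  shows "burkholder p e \<alpha> \<beta> \<le> 0"
proof -
  let ?M = "max \<bar>\<alpha>\<bar> \<bar>\<beta>\<bar>"
  have "?M \<le> \<bar>\<alpha> + \<beta>\<bar>"
    using assms(1) by (auto simp: zero_le_mult_iff)
  then have "1 * ?M \<le> e * \<bar>\<alpha> + \<beta>\<bar>"
    using assms(2) by (intro mult_mono) auto
  then have "?M * ?M powr (p - 1) \<le> e * \<bar>\<alpha> + \<beta>\<bar> * ?M powr (p - 1)"
    by (intro mult_right_mono) auto
  moreover have "?M * ?M powr (p - 1) = ?M powr p"
    using powr_mult_base[of ?M "p - 1"] by simp
  ultimately show ?thesis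
    by (simp add: burkholder_def)
qed

text \<open>Write M for the maximum and s for \<bar>\<alpha> + \<beta>\<bar>. If 2es \<le> M, the
  subtracted term is at most half of M^p. Otherwise M < 2es, and the subtracted term is at most
  (2es)^p. Either way M^p / 2 is controlled, which gives the factor 2; the factor 2^p comes from
  \<bar>\<alpha> - \<beta>\<bar> \<le> 2M.\<close>

lemma burkholder_lower_bound:
  assumes p: "1 < p" and e: "1 \<le> e"
  shows "\<bar>\<alpha> - \<beta>\<bar> powr p
     \<le> 2 * 2 powr p * (burkholder p e \<alpha> \<beta> + (2 * e) powr p * \<bar>\<alpha> + \<beta>\<bar> powr p)"
proof -
  let ?M = "max \<bar>\<alpha>\<bar> \<bar>\<beta>\<bar>" and ?s = "\<bar>\<alpha> + \<beta>\<bar>"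
  have M: "?M * ?M powr (p - 1) = ?M powr p"
    using powr_mult_base[of ?M "p - 1"] by simp
  have "\<bar>\<alpha> - \<beta>\<bar> powr p \<le> (2 * ?M) powr p"
    using p by (intro powr_mono2) auto
  also have "\<dots> = 2 * 2 powr p * (?M powr p / 2)"
    by (simp add: powr_mult)
  finally have bound: "\<bar>\<alpha> - \<beta>\<bar> powr p \<le> 2 * 2 powr p * (?M powr p / 2)" .
  have half: "?M powr p / 2 \<le> burkholder p e \<alpha> \<beta> + (2 * e) powr p * ?s powr p"
  proof (cases "2 * e * ?s \<le> ?M")
    case True
    then have "2 * e * ?s * ?M powr (p - 1) \<le> ?M powr p"
      unfolding M[symmetric] by (intro mult_right_mono) auto
    then have "?M powr p / 2 \<le> burkholder p e \<alpha> \<beta>"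
      by (simp add: burkholder_def field_simps)
    then show ?thesis
      by (simp add: add_increasing2)
  next
    case False
    then have "e * ?s * ?M powr (p - 1) \<le> e * ?s * (2 * e * ?s) powr (p - 1)"
      using p e by (intro mult_left_mono powr_mono2) auto
    also have "\<dots> = (2 * e * ?s) powr p / 2"
      using powr_mult_base[of "2 * e * ?s" "p - 1"] e by simp
    also have "\<dots> \<le> (2 * e * ?s) powr p"
      by simp
    finally have "e * ?s * ?M powr (p - 1) \<le> (2 * e) powr p * ?s powr p"
      using e by (simp add: powr_mult)
    then show ?thesis
      by (simp add: burkholder_def add_increasing2)
  qed
  show ?thesis
    by (rule order_trans[OF bound mult_left_mono[OF half]]) simp
qed

section \<open>Unconditionality of the Haar system\<close>

abbreviation unit_measure :: "real measure" where
  "unit_measure \<equiv> lebesgue_on {0..1}"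

text \<open>The support of the \<open>n\<close>-th Haar function, \<open>n \<ge> 2\<close>, is \<open>[haar_left n, haar_left n + 2 * haar_half n]\<close>.\<close>

definition haar_left :: "nat \<Rightarrow> real" where
  "haar_left n = (real n - 2 ^ floor_log (n - 1) - 1) / 2 ^ floor_log (n - 1)"

definition haar_half :: "nat \<Rightarrow> real" where
  "haar_half n = 1 / 2 ^ (floor_log (n - 1) + 1)"

lemma haar_half_pos: "0 < haar_half n"
  by (simp add: haar_half_def)

lemma haar_index_cases:
  assumes "2 \<le> n"
  obtains k j where "1 \<le> j" "j \<le> 2 ^ k" "n = 2 ^ k + j" "floor_log (n - 1) = k"
proof -
  define k where "k = floor_log (n - 1)"
  have "2 ^ k \<le> n - 1" "n - 1 < 2 ^ (k + 1)"
    using assms floor_log_exp2_le[of "n - 1"] floor_log_exp2_gt[of "n - 1"] by (auto simp: k_def)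
  then show ?thesis
    using that[of "n - 2 ^ k" k] assms k_def by auto
qed

lemma haar_left_bounds:
  assumes "2 \<le> n"
  shows "0 \<le> haar_left n" "haar_left n + 2 * haar_half n \<le> 1"
proof -
  from assms obtain k j where kj: "1 \<le> j" "j \<le> 2 ^ k" "n = 2 ^ k + j" "floor_log (n - 1) = k"
    by (rule haar_index_cases)
  have "haar_left n = (real j - 1) / 2 ^ k" "haar_half n = 1 / 2 ^ (k + 1)"
    unfolding haar_left_def haar_half_def kj(4) by (simp_all add: kj(3))
  then have "haar_left n = (real j - 1) / 2 ^ k" "haar_left n + 2 * haar_half n = real j / 2 ^ k"
    by (simp_all add: field_simps)
  moreover have "real j \<le> real (2 ^ k)" "1 \<le> real j"
    using kj(1,2) by (simp_all only: of_nat_le_iff)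
  ultimately show "0 \<le> haar_left n" "haar_left n + 2 * haar_half n \<le> 1"
    by simp_all
qed

lemma haar_fun_values:
  assumes "2 \<le> n"
  shows "haar_left n < t \<Longrightarrow> t < haar_left n + haar_half n \<Longrightarrow> haar_fun n t = 1"
    and "haar_left n + haar_half n < t \<Longrightarrow> t < haar_left n + 2 * haar_half n \<Longrightarrow> haar_fun n t = - 1"
    and "t < haar_left n \<or> haar_left n + 2 * haar_half n < t \<Longrightarrow> haar_fun n t = 0"
proof -
  from assms obtain k j where kj: "1 \<le> j" "j \<le> 2 ^ k" "n = 2 ^ k + j" "floor_log (n - 1) = k"
    by (rule haar_index_cases)
  have "haar_left n = (real j - 1) / 2 ^ k" "haar_half n = 1 / 2 ^ (k + 1)"
    unfolding haar_left_def haar_half_def kj(4) by (simp_all add: kj(3))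
  then have pts: "(2 * real j - 2) / 2 ^ (k + 1) = haar_left n"
    "(2 * real j - 1) / 2 ^ (k + 1) = haar_left n + haar_half n"
    "2 * real j / 2 ^ (k + 1) = haar_left n + 2 * haar_half n"
    by (simp_all add: field_simps)
  have eq: "haar_fun n t = dyadic_haar k j t"
    using haar_fun_dyadic[OF kj(1,2)] kj(3) by simp
  show "haar_left n < t \<Longrightarrow> t < haar_left n + haar_half n \<Longrightarrow> haar_fun n t = 1"
    "haar_left n + haar_half n < t \<Longrightarrow> t < haar_left n + 2 * haar_half n \<Longrightarrow> haar_fun n t = - 1"
    "t < haar_left n \<or> haar_left n + 2 * haar_half n < t \<Longrightarrow> haar_fun n t = 0"
    unfolding eq dyadic_haar_def pts using haar_half_pos[of n] by auto
qed

text \<open>Dyadic nesting. An earlier function of coarser level \<open>i < k\<close> has its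
  breakpoints at multiples of \<open>1 / 2 ^ (i + 1)\<close>, hence of \<open>1 / 2 ^ k\<close>, and
  none of these lies strictly inside the support of the later one. An earlier function of the same
  level vanishes there, because its support lies to the left.\<close>

lemma haar_fun_const_on_support:
  assumes "2 \<le> n" "1 \<le> m" "m < n"
  obtains c where
    "\<And>t. haar_left n < t \<Longrightarrow> t < haar_left n + 2 * haar_half n \<Longrightarrow> haar_fun m t = c"
proof -
  from assms(1) obtain k j where kj: "1 \<le> j" "j \<le> 2 ^ k" "n = 2 ^ k + j" "floor_log (n - 1) = k"
    by (rule haar_index_cases)
  have "haar_left n = (real j - 1) / 2 ^ k" "haar_half n = 1 / 2 ^ (k + 1)"
    unfolding haar_left_def haar_half_def kj(4) by (simp_all add: kj(3))
  then have I: "haar_left n = (real j - 1) / 2 ^ k" "haar_left n + 2 * haar_half n = real j / 2 ^ k"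
    by (simp_all add: field_simps)
  show ?thesis
  proof (cases "m = 1")
    case True
    then show ?thesis
      using that[of 1] by (simp add: haar_fun_def)
  next
    case False
    then have "2 \<le> m" using assms by simp
    then obtain i r where ir: "1 \<le> r" "r \<le> 2 ^ i" "m = 2 ^ i + r" "floor_log (m - 1) = i"
      by (rule haar_index_cases)
    have eq: "haar_fun m t = dyadic_haar i r t" for t
      using haar_fun_dyadic[OF ir(1,2)] ir(3) by simp
    have "i \<le> k"
      unfolding ir(4)[symmetric] kj(4)[symmetric] using assms by (intro floor_log_le_iff) simp
    show ?thesis
    proof (cases "i = k")
      case True
      then have "r \<le> j - 1"
        using assms ir kj by simp
      then have r: "real r \<le> real j - 1"
        using kj by linarith
      show ?thesis
      proof (rule that[of 0])
        fix t assume "haar_left n < t"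
        moreover have "2 * real r / 2 ^ (i + 1) \<le> haar_left n"
          using r by (simp add: I True divide_right_mono)
        moreover have "(2 * real r - 1) / 2 ^ (i + 1) \<le> 2 * real r / 2 ^ (i + 1)"
          by (intro divide_right_mono) auto
        ultimately show "haar_fun m t = 0"
          by (simp add: eq dyadic_haar_def)
      qed
    next
      case False
      with \<open>i \<le> k\<close> have "i + 1 \<le> k" by simp
      have breakpoint: "(x < t \<longleftrightarrow> x < s) \<and> (t < x \<longleftrightarrow> s < x)"
        if t: "haar_left n < t" "t < haar_left n + 2 * haar_half n"
          and s: "haar_left n < s" "s < haar_left n + 2 * haar_half n"
          and x: "x = real q / 2 ^ (i + 1)" for s t x and q :: nat
      proof -
        obtain l where l: "k = i + 1 + l"
          using \<open>i + 1 \<le> k\<close> le_Suc_ex by blast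
        have x_eq: "x = real (q * 2 ^ l) / 2 ^ k"
          unfolding x l by (simp add: power_add)
        have "q * 2 ^ l + 1 \<le> j \<or> j \<le> q * 2 ^ l"
          by linarith
        then have "real (q * 2 ^ l + 1) \<le> real j \<or> real j \<le> real (q * 2 ^ l)"
          by (simp only: of_nat_le_iff)
        then consider "real (q * 2 ^ l) \<le> real j - 1" | "real j \<le> real (q * 2 ^ l)"
          by (auto simp del: of_nat_mult)
        then have "x \<le> haar_left n \<or> haar_left n + 2 * haar_half n \<le> x"
        proof cases
          case 1
          show ?thesis
            unfolding x_eq I(1) by (rule disjI1, rule divide_right_mono[OF 1]) simp
        next
          case 2
          show ?thesis
            unfolding x_eq I(2) by (rule disjI2, rule divide_right_mono[OF 2]) simp
        qed
        with s t show ?thesis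
          by linarith
      qed
      show ?thesis
      proof (rule that[of "haar_fun m (haar_left n + haar_half n)"])
        fix t assume t: "haar_left n < t" "t < haar_left n + 2 * haar_half n"
        let ?s = "haar_left n + haar_half n"
        have s: "haar_left n < ?s" "?s < haar_left n + 2 * haar_half n"
          using haar_half_pos[of n] by auto
        \<comment> \<open>\<open>breakpoint\<close> needs natural numerators; the truncated
          subtractions are exact because \<open>1 \<le> r\<close>.\<close>
        have "2 * real r - 2 = real (2 * r - 2)" "2 * real r - 1 = real (2 * r - 1)"
          "2 * real r = real (2 * r)"
          using ir(1) by (auto simp: of_nat_diff)
        note bp = breakpoint[OF t s arg_cong[where f = "\<lambda>x. x / 2 ^ (i + 1)", OF this(1)]]
          breakpoint[OF t s arg_cong[where f = "\<lambda>x. x / 2 ^ (i + 1)", OF this(2)]]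
          breakpoint[OF t s arg_cong[where f = "\<lambda>x. x / 2 ^ (i + 1)", OF this(3)]]
        show "haar_fun m t = haar_fun m ?s"
          unfolding eq dyadic_haar_def
          by (simp only: atLeastAtMost_iff greaterThanAtMost_iff bp not_less[symmetric])
      qed
    qed
  qed
qed

lemma haar_fun_le_1: "\<bar>haar_fun n t\<bar> \<le> 1"
  by (simp add: haar_fun_def dyadic_haar_def)

lemma finite_measure_unit: "finite_measure unit_measure"
  by (rule finite_measure_lebesgue_on) auto

lemma measure_unit_interval:
  assumes "0 \<le> a" "a \<le> b" "b \<le> 1"
  shows "measure unit_measure {a<..<b} = b - a"
  using assms by (subst measure_restrict_space) auto

text \<open>The common form of three integrands below: the square of a Haar function, its product
  with an earlier one, and the increment of the Burkholder integrand. The three breakpoints are left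
  free, being a null set.\<close>

lemma has_bochner_integral_haar_step:
  assumes n: "2 \<le> n" and [measurable]: "h \<in> borel_measurable unit_measure"
    and left: "\<And>t. haar_left n < t \<Longrightarrow> t < haar_left n + haar_half n \<Longrightarrow> h t = c"
    and right: "\<And>t. haar_left n + haar_half n < t \<Longrightarrow> t < haar_left n + 2 * haar_half n \<Longrightarrow> h t = d"
    and outside: "\<And>t. t < haar_left n \<or> haar_left n + 2 * haar_half n < t \<Longrightarrow> h t = 0"
  shows "has_bochner_integral unit_measure h ((c + d) * haar_half n)"
proof -
  let ?a = "haar_left n" and ?b = "haar_left n + haar_half n" and ?c = "haar_left n + 2 * haar_half n"
  note bounds = haar_left_bounds[OF n] haar_half_pos[of n]
  let ?k = "\<lambda>t. c * indicator {?a<..<?b} t + d * indicator {?b<..<?c} t"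
  have sub: "{?a<..<?b} \<in> sets unit_measure" "{?b<..<?c} \<in> sets unit_measure"
    using bounds by (auto simp: sets_restrict_space_iff)
  interpret finite_measure unit_measure by (rule finite_measure_unit)
  have "has_bochner_integral unit_measure ?k
      (c * measure unit_measure {?a<..<?b} + d * measure unit_measure {?b<..<?c})"
    using sub by (intro has_bochner_integral_add has_bochner_integral_mult_right
        has_bochner_integral_real_indicator) (auto simp: less_top[symmetric])
  then have k: "has_bochner_integral unit_measure ?k ((c + d) * haar_half n)"
    using bounds by (simp add: measure_unit_interval algebra_simps)
  have "AE t in unit_measure. t \<notin> {?a, ?b, ?c}"
  proof -
    have "AE t in lebesgue. t \<notin> {?a, ?b, ?c}"
      by (intro AE_not_in finite_imp_null_set_lborel) auto
    then show ?thesis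
      by (subst AE_restrict_space_iff) auto
  qed
  then have "AE t in unit_measure. h t = ?k t"
    by eventually_elim (auto simp: indicator_def left right outside not_less
        intro: left right outside)
  then show ?thesis
    using k sub by (subst has_bochner_integral_cong_AE[where g = ?k]) auto
qed


lemma integrable_unit_bounded:
  fixes f :: "real \<Rightarrow> real"
  assumes "f \<in> borel_measurable unit_measure" "\<And>t. \<bar>f t\<bar> \<le> B"
  shows "integrable unit_measure f"
  using assms finite_measure_unit
  by (intro finite_measure.integrable_const_bound[where B = B]) auto

declare haar_fun_measurable [measurable]

section \<open>Orthogonality of the Haar functions\<close>

lemma integral_haar_square_pos:
  assumes "1 \<le> n"
  shows "0 < (\<integral>t. haar_fun n t * haar_fun n t \<partial>unit_measure)"
proof (cases "n = 1")
  case True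
  have "measure unit_measure {0..1} = 1"
    by (subst measure_restrict_space) auto
  then show ?thesis
    using True by (simp add: haar_fun_def)
next
  case False
  then have n: "2 \<le> n" using assms by simp
  have "has_bochner_integral unit_measure (\<lambda>t. haar_fun n t * haar_fun n t) ((1 + 1) * haar_half n)"
    by (rule has_bochner_integral_haar_step[OF n]) (use haar_fun_values[OF n] in auto)
  then show ?thesis
    using haar_half_pos[of n] by (simp add: has_bochner_integral_iff)
qed

text \<open>The function with the smaller index is a constant \<open>c\<close> on the support of the
  other, so the product is \<open>c\<close> on one half and \<open>- c\<close> on the other.\<close>

lemma integral_haar_orthogonal:
  assumes "1 \<le> m" "1 \<le> n" "m \<noteq> n"
  shows "(\<integral>t. haar_fun m t * haar_fun n t \<partial>unit_measure) = 0"
proof -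
  have less: "(\<integral>t. haar_fun m t * haar_fun n t \<partial>unit_measure) = 0"
    if mn: "1 \<le> m" "m < n" for m n
  proof -
    have n: "2 \<le> n" using mn by simp
    obtain c where c: "\<And>t. haar_left n < t \<Longrightarrow> t < haar_left n + 2 * haar_half n \<Longrightarrow> haar_fun m t = c"
      using haar_fun_const_on_support[OF n mn] by blast
    have "has_bochner_integral unit_measure (\<lambda>t. haar_fun m t * haar_fun n t)
        ((c + - c) * haar_half n)"
      by (rule has_bochner_integral_haar_step[OF n])
        (use haar_fun_values[OF n] c haar_half_pos[of n] in auto)
    then show ?thesis
      by (simp add: has_bochner_integral_iff)
  qed
  consider "m < n" | "n < m" using assms by linarith
  then show ?thesis
  proof cases
    case 1
    then show ?thesis using less assms by blast
  next
    case 2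
    then show ?thesis using less[of n m] assms by (simp add: mult.commute)
  qed
qed

section \<open>Finite Haar sums and the induction with Burkholder's function\<close>

definition haar_sum :: "(nat \<Rightarrow> real) \<Rightarrow> nat \<Rightarrow> real \<Rightarrow> real" where
  "haar_sum a N t = (\<Sum>n = 1..N. a n * haar_fun n t)"

lemma haar_sum_measurable [measurable]: "haar_sum a N \<in> borel_measurable unit_measure"
  unfolding haar_sum_def[abs_def] by measurable

lemma haar_sum_Suc: "haar_sum a (Suc N) t = haar_sum a N t + a (Suc N) * haar_fun (Suc N) t"
  by (simp add: haar_sum_def)

lemma haar_sum_bounded: "\<bar>haar_sum a N t\<bar> \<le> (\<Sum>n = 1..N. \<bar>a n\<bar>)"
  unfolding haar_sum_def
  by (rule order_trans[OF sum_abs sum_mono]) (simp add: abs_mult mult_left_le haar_fun_le_1)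

lemma integrable_haar_sum_powr:
  assumes "0 \<le> p"
  shows "integrable unit_measure (\<lambda>t. \<bar>haar_sum a N t\<bar> powr p)"
proof (rule integrable_unit_bounded)
  show "\<bar>\<bar>haar_sum a N t\<bar> powr p\<bar> \<le> (\<Sum>n = 1..N. \<bar>a n\<bar>) powr p" for t
    using haar_sum_bounded[of a N t] assms by (simp add: powr_mono2)
qed auto

lemma haar_sum_const_on_support:
  assumes "2 \<le> Suc N"
  obtains c where "\<And>t. haar_left (Suc N) < t \<Longrightarrow> t < haar_left (Suc N) + 2 * haar_half (Suc N) \<Longrightarrow>
    haar_sum a N t = c"
proof -
  have "\<forall>m\<in>{1..N}. \<exists>c. \<forall>t. haar_left (Suc N) < t \<longrightarrow> t < haar_left (Suc N) + 2 * haar_half (Suc N) \<longrightarrow>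
      haar_fun m t = c"
  proof
    fix m assume "m \<in> {1..N}"
    then have "1 \<le> m" "m < Suc N" by auto
    then show "\<exists>c. \<forall>t. haar_left (Suc N) < t \<longrightarrow> t < haar_left (Suc N) + 2 * haar_half (Suc N) \<longrightarrow>
        haar_fun m t = c"
      using haar_fun_const_on_support[OF assms] by metis
  qed
  then obtain c where c: "\<forall>m\<in>{1..N}. \<forall>t. haar_left (Suc N) < t \<longrightarrow>
      t < haar_left (Suc N) + 2 * haar_half (Suc N) \<longrightarrow> haar_fun m t = c m"
    by (auto dest!: bchoice)
  show ?thesis
  proof (rule that[of "\<Sum>m = 1..N. a m * c m"])
    show "haar_sum a N t = (\<Sum>m = 1..N. a m * c m)"
      if "haar_left (Suc N) < t" "t < haar_left (Suc N) + 2 * haar_half (Suc N)" for t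
      unfolding haar_sum_def using c that by (intro sum.cong) auto
  qed
qed

lemma burkholder_measurable [measurable]:
  assumes [measurable]: "f \<in> borel_measurable M" "g \<in> borel_measurable M"
  shows "(\<lambda>t. burkholder p e (f t) (g t)) \<in> borel_measurable M"
  unfolding burkholder_def by measurable

text \<open>On the support of the next Haar function both old sums are constants \<open>x\<close>
  and \<open>y\<close>. The new pair is (x + a_n, y + b_n) on one half and (x - a_n, y - b_n) on the
  other, so the integral changes by the half length times a second difference of the Burkholder
  function.\<close>

lemma integral_burkholder_haar_sum:
  assumes p: "1 < p" and e: "1 \<le> e" "p \<le> 2 * e" "p \<le> 2 * e * (p - 1)"
    and disjoint: "\<And>n. a n = 0 \<or> b n = 0"
  shows "integrable unit_measure (\<lambda>t. burkholder p e (haar_sum a N t) (haar_sum b N t)) \<and>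
    (\<integral>t. burkholder p e (haar_sum a N t) (haar_sum b N t) \<partial>unit_measure) \<le> 0"
proof (induction N)
  case 0
  then show ?case
    by (simp add: haar_sum_def burkholder_def)
next
  case (Suc N)
  show ?case
  proof (cases "N = 0")
    case True
    \<comment> \<open>The first Haar function is the constant 1 and has no halves of opposite sign.
      Sums of length 1 are therefore settled pointwise, using \<open>a 1 * b 1 = 0\<close>.\<close>
    have "burkholder p e (a 1) (b 1) \<le> 0"
      using disjoint[of 1] e by (intro burkholder_nonpos) auto
    moreover have "burkholder p e (haar_sum a (Suc N) t) (haar_sum b (Suc N) t) = burkholder p e (a 1) (b 1)" for t
      by (simp add: haar_sum_def True haar_fun_def)
    ultimately show ?thesis
      using finite_measure.integrable_const[OF finite_measure_unit]
      by (simp add: mult_nonneg_nonpos)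
  next
    case False
    define n where "n = Suc N"
    have n: "2 \<le> n" using False by (simp add: n_def)
    obtain x where x: "\<And>t. haar_left n < t \<Longrightarrow> t < haar_left n + 2 * haar_half n \<Longrightarrow> haar_sum a N t = x"
      using haar_sum_const_on_support[of N a] n unfolding n_def by blast
    obtain y where y: "\<And>t. haar_left n < t \<Longrightarrow> t < haar_left n + 2 * haar_half n \<Longrightarrow> haar_sum b N t = y"
      using haar_sum_const_on_support[of N b] n unfolding n_def by blast
    let ?W = "burkholder p e"
    let ?old = "\<lambda>t. ?W (haar_sum a N t) (haar_sum b N t)"
    let ?new = "\<lambda>t. ?W (haar_sum a n t) (haar_sum b n t)"
    let ?c = "?W (x + a n) (y + b n) - ?W x y" and ?d = "?W (x - a n) (y - b n) - ?W x y"
    have sum_n: "haar_sum a n t = haar_sum a N t + a n * haar_fun n t"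
      "haar_sum b n t = haar_sum b N t + b n * haar_fun n t" for t
      by (simp_all add: n_def haar_sum_Suc)
    have step: "has_bochner_integral unit_measure (\<lambda>t. ?new t - ?old t) ((?c + ?d) * haar_half n)"
    proof (rule has_bochner_integral_haar_step[OF n])
      show "?new t - ?old t = ?c" if "haar_left n < t" "t < haar_left n + haar_half n" for t
        using that haar_half_pos[of n] haar_fun_values(1)[OF n that] by (simp add: sum_n x y)
      show "?new t - ?old t = ?d"
        if "haar_left n + haar_half n < t" "t < haar_left n + 2 * haar_half n" for t
        using that haar_half_pos[of n] haar_fun_values(2)[OF n that] by (simp add: sum_n x y)
      show "?new t - ?old t = 0" if "t < haar_left n \<or> haar_left n + 2 * haar_half n < t" for t
        using haar_fun_values(3)[OF n that] by (simp add: sum_n)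
    qed measurable
    \<comment> \<open>By \<open>disjoint\<close> only one argument moves, so midpoint concavity in
      that argument applies; \<open>burkholder_commute\<close> covers a move of the second
      one.\<close>
    have "?c + ?d \<le> 0"
      using disjoint[of n] burkholder_midpoint[OF p e, of x "a n" y]
        burkholder_midpoint[OF p e, of y "b n" x]
      by (auto simp: burkholder_commute[of p e x] burkholder_commute[of p e "x + a n"])
    then have neg: "(?c + ?d) * haar_half n \<le> 0"
      using haar_half_pos[of n] by (simp add: mult_nonpos_nonneg)
    have "has_bochner_integral unit_measure (\<lambda>t. ?old t + (?new t - ?old t))
        ((\<integral>t. ?old t \<partial>unit_measure) + (?c + ?d) * haar_half n)"
      using Suc.IH by (intro has_bochner_integral_add step) (simp add: has_bochner_integral_integrable)
    then have "has_bochner_integral unit_measure ?new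
        ((\<integral>t. ?old t \<partial>unit_measure) + (?c + ?d) * haar_half n)"
      by simp
    then show ?thesis
      unfolding n_def[symmetric] using Suc.IH neg by (auto simp: has_bochner_integral_iff)
  qed
qed

lemma haar_sum_add: "haar_sum a N t + haar_sum b N t = haar_sum (\<lambda>n. a n + b n) N t"
  by (simp add: haar_sum_def sum.distrib distrib_right)

lemma haar_sum_diff: "haar_sum a N t - haar_sum b N t = haar_sum (\<lambda>n. a n - b n) N t"
  by (simp add: haar_sum_def sum_subtractf left_diff_distrib)

lemma haar_sum_scale: "c * haar_sum a N t = haar_sum (\<lambda>n. c * a n) N t"
  by (simp add: haar_sum_def sum_distrib_left mult.assoc)

lemma haar_sum_cong: "(\<And>n. 1 \<le> n \<Longrightarrow> n \<le> N \<Longrightarrow> a n = b n) \<Longrightarrow> haar_sum a N t = haar_sum b N t"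
  by (simp add: haar_sum_def)

text \<open>Take for \<alpha> the terms with sign 1 and for \<beta> those with sign -1. Their sum is
  the given Haar sum, their difference the transformed one, and no index occurs in both. Integrating
  \<open>burkholder_lower_bound\<close> and dropping the nonpositive integral gives the
  claim.\<close>

lemma haar_unconditional_signs:
  assumes p: "1 < p" and e: "1 \<le> e" "p \<le> 2 * e" "p \<le> 2 * e * (p - 1)"
    and signs: "\<And>n. \<epsilon> n \<in> {-1, 1}"
  shows "(\<integral>t. \<bar>haar_sum (\<lambda>n. \<epsilon> n * a n) N t\<bar> powr p \<partial>unit_measure)
    \<le> 2 * 2 powr p * (2 * e) powr p * (\<integral>t. \<bar>haar_sum a N t\<bar> powr p \<partial>unit_measure)"
proof -
  let ?a = "\<lambda>n. if \<epsilon> n = 1 then a n else 0" and ?b = "\<lambda>n. if \<epsilon> n = 1 then 0 else a n"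
  let ?W = "\<lambda>t. burkholder p e (haar_sum ?a N t) (haar_sum ?b N t)"
  have W: "integrable unit_measure ?W" "(\<integral>t. ?W t \<partial>unit_measure) \<le> 0"
    using integral_burkholder_haar_sum[OF p e, of ?a ?b N] by auto
  have sum: "haar_sum ?a N t + haar_sum ?b N t = haar_sum a N t" for t
    unfolding haar_sum_add by (intro haar_sum_cong) auto
  have diff: "haar_sum ?a N t - haar_sum ?b N t = haar_sum (\<lambda>n. \<epsilon> n * a n) N t" for t
    unfolding haar_sum_diff
  proof (rule haar_sum_cong)
    show "?a n - ?b n = \<epsilon> n * a n" for n
      using signs[of n] by auto
  qed
  have "(\<integral>t. \<bar>haar_sum (\<lambda>n. \<epsilon> n * a n) N t\<bar> powr p \<partial>unit_measure)
      \<le> (\<integral>t. 2 * 2 powr p * (?W t + (2 * e) powr p * \<bar>haar_sum a N t\<bar> powr p) \<partial>unit_measure)"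
  proof (rule integral_mono)
    show "\<bar>haar_sum (\<lambda>n. \<epsilon> n * a n) N t\<bar> powr p
        \<le> 2 * 2 powr p * (?W t + (2 * e) powr p * \<bar>haar_sum a N t\<bar> powr p)" for t
      using burkholder_lower_bound[OF p e(1), of "haar_sum ?a N t" "haar_sum ?b N t"]
      unfolding sum diff .
  qed (use W p in \<open>auto intro!: Bochner_Integration.integrable_add integrable_mult_right
        integrable_haar_sum_powr\<close>)
  also have "\<dots> = 2 * 2 powr p * ((\<integral>t. ?W t \<partial>unit_measure) +
      (2 * e) powr p * (\<integral>t. \<bar>haar_sum a N t\<bar> powr p \<partial>unit_measure))"
    using W p by (simp add: integrable_haar_sum_powr)
  also have "\<dots> \<le> 2 * 2 powr p * (0 + (2 * e) powr p * (\<integral>t. \<bar>haar_sum a N t\<bar> powr p \<partial>unit_measure))"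
    using W by (intro mult_left_mono add_right_mono) auto
  finally show ?thesis
    by (simp add: mult.assoc)
qed

lemma haar_multiplier_le_of_signs:
  assumes p: "1 \<le> p"
    and signs: "\<And>\<epsilon>. (\<And>n. \<epsilon> n \<in> {-1, 1}) \<Longrightarrow>
      (\<integral>t. \<bar>haar_sum (\<lambda>n. \<epsilon> n * a n) N t\<bar> powr p \<partial>unit_measure) \<le> B"
    and b: "\<And>n. \<bar>b n\<bar> \<le> (1::real)"
  shows "(\<integral>t. \<bar>haar_sum (\<lambda>n. b n * a n) N t\<bar> powr p \<partial>unit_measure) \<le> B"
proof -
  let ?I = "\<lambda>b. \<integral>t. \<bar>haar_sum (\<lambda>n. b n * a n) N t\<bar> powr p \<partial>unit_measure"
  \<comment> \<open>\<open>?I\<close> is convex in each entry of \<open>b\<close>, so the entries can be pushed to \<open>\<plusminus>1\<close> one at a time.\<close>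
  have "?I b \<le> B" if "\<And>n. \<bar>b n\<bar> \<le> 1" "\<And>n. k \<le> n \<Longrightarrow> b n \<in> {-1, 1}" for k b
    using that
  proof (induction k arbitrary: b)
    case 0
    then show ?case
      using signs by simp
  next
    case (Suc k)
    define b1 where "b1 = b(k := 1)"
    define b2 where "b2 = b(k := -1)"
    \<comment> \<open>The weight that solves b_k = (1 - \<theta>) * 1 + \<theta> * (-1).\<close>
    define \<theta> where "\<theta> = (1 - b k) / 2"
    have \<theta>: "0 \<le> \<theta>" "\<theta> \<le> 1"
      using Suc.prems(1)[of k] by (auto simp: \<theta>_def)
    have "?I b1 \<le> B" "?I b2 \<le> B"
      using Suc.prems by (intro Suc.IH; auto simp: b1_def b2_def not_less_eq_eq le_Suc_eq
        dest: le_neq_implies_less)+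
    have split: "haar_sum (\<lambda>n. b n * a n) N t =
        (1 - \<theta>) *\<^sub>R haar_sum (\<lambda>n. b1 n * a n) N t + \<theta> *\<^sub>R haar_sum (\<lambda>n. b2 n * a n) N t" for t
      unfolding real_scaleR_def haar_sum_scale haar_sum_add
      by (intro haar_sum_cong) (auto simp: b1_def b2_def \<theta>_def field_simps)
    have "?I b \<le> (\<integral>t. (1 - \<theta>) * \<bar>haar_sum (\<lambda>n. b1 n * a n) N t\<bar> powr p +
        \<theta> * \<bar>haar_sum (\<lambda>n. b2 n * a n) N t\<bar> powr p \<partial>unit_measure)"
    proof (rule integral_mono)
      show "\<bar>haar_sum (\<lambda>n. b n * a n) N t\<bar> powr p \<le> (1 - \<theta>) * \<bar>haar_sum (\<lambda>n. b1 n * a n) N t\<bar> powr p +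
        \<theta> * \<bar>haar_sum (\<lambda>n. b2 n * a n) N t\<bar> powr p" for t
        unfolding split using \<theta> by (intro convex_onD[OF convex_on_abs_powr[OF p]]) auto
    qed (use p in \<open>auto intro!: Bochner_Integration.integrable_add integrable_mult_right
        integrable_haar_sum_powr\<close>)
    also have "\<dots> = (1 - \<theta>) * ?I b1 + \<theta> * ?I b2"
      using p by (simp add: integrable_haar_sum_powr)
    also have "\<dots> \<le> (1 - \<theta>) * B + \<theta> * B"
      using \<theta> \<open>?I b1 \<le> B\<close> \<open>?I b2 \<le> B\<close> by (intro add_mono mult_left_mono) auto
    finally show ?case
      by (simp add: algebra_simps)
  qed
  \<comment> \<open>A sum of length \<open>N\<close> does not see entries beyond \<open>N\<close>.
    Setting them to 1 leaves only finitely many entries to push.\<close>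
  from this[of "\<lambda>n. if n \<le> N then b n else 1" "Suc N"]
  have "?I (\<lambda>n. if n \<le> N then b n else 1) \<le> B"
    using b by simp
  moreover have "haar_sum (\<lambda>n. (if n \<le> N then b n else 1) * a n) N t = haar_sum (\<lambda>n. b n * a n) N t" for t
    by (intro haar_sum_cong) auto
  ultimately show ?thesis
    by simp
qed

lemma haar_unconditional:
  assumes p: "1 < p"
  obtains K where "0 \<le> K"
    "\<And>a b N. (\<And>n. \<bar>b n\<bar> \<le> (1::real)) \<Longrightarrow>
      (\<integral>t. \<bar>haar_sum (\<lambda>n. b n * a n) N t\<bar> powr p \<partial>unit_measure)
      \<le> K * (\<integral>t. \<bar>haar_sum a N t\<bar> powr p \<partial>unit_measure)"
proof -
  \<comment> \<open>The three entries of the maximum ensure the three conditions on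
    \<open>e\<close>. The resulting constant depends on \<open>p\<close> alone, not on the length of
    the sum.\<close>
  define e where "e = max 1 (max p (p / (p - 1)))"
  have "p / (p - 1) \<le> 2 * e"
    using p by (auto simp: e_def)
  then have "p \<le> 2 * e * (p - 1)"
    using p by (simp add: field_simps)
  then have e: "1 \<le> e" "p \<le> 2 * e" "p \<le> 2 * e * (p - 1)"
    using p by (auto simp: e_def)
  show ?thesis
  proof (rule that[of "2 * 2 powr p * (2 * e) powr p"])
    fix a b :: "nat \<Rightarrow> real" and N
    assume b: "\<And>n. \<bar>b n\<bar> \<le> 1"
    show "(\<integral>t. \<bar>haar_sum (\<lambda>n. b n * a n) N t\<bar> powr p \<partial>unit_measure)
      \<le> 2 * 2 powr p * (2 * e) powr p * (\<integral>t. \<bar>haar_sum a N t\<bar> powr p \<partial>unit_measure)"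
    proof (rule haar_multiplier_le_of_signs)
      show "(\<integral>t. \<bar>haar_sum (\<lambda>n. \<epsilon> n * a n) N t\<bar> powr p \<partial>unit_measure)
          \<le> 2 * 2 powr p * (2 * e) powr p * (\<integral>t. \<bar>haar_sum a N t\<bar> powr p \<partial>unit_measure)"
        if "\<And>n. \<epsilon> n \<in> {-1, 1}" for \<epsilon>
        using that by (rule haar_unconditional_signs[OF p e])
    qed (use p b in auto)
  qed simp
qed

section \<open>Completeness\<close>

lemma abs_add_powr_le:
  fixes a b p :: real
  assumes "0 \<le> p"
  shows "\<bar>a + b\<bar> powr p \<le> 2 powr p * (\<bar>a\<bar> powr p + \<bar>b\<bar> powr p)"
proof -
  have "\<bar>a + b\<bar> powr p \<le> (2 * max \<bar>a\<bar> \<bar>b\<bar>) powr p"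
    using assms by (intro powr_mono2) auto
  also have "\<dots> = 2 powr p * max \<bar>a\<bar> \<bar>b\<bar> powr p"
    by (simp add: powr_mult)
  also have "\<dots> \<le> 2 powr p * (\<bar>a\<bar> powr p + \<bar>b\<bar> powr p)"
    by (intro mult_left_mono) (auto simp: max_def)
  finally show ?thesis .
qed

text \<open>For \<bar>y\<bar> > s the ratio \<bar>y\<bar> / s exceeds 1 and is at most its p-th
  power. Integrated, with \<open>s\<close> a bound for the L_p norm, this bounds the L_1 norm
  linearly in \<open>s\<close> on a finite measure space.\<close>

lemma abs_le_add_powr:
  fixes y s p :: real
  assumes "1 \<le> p" "0 < s"
  shows "\<bar>y\<bar> \<le> s + s * (\<bar>y\<bar> powr p / s powr p)"
proof (cases "\<bar>y\<bar> \<le> s")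
  case True
  then show ?thesis
    using assms by (simp add: add_increasing2)
next
  case False
  then have "\<bar>y\<bar> / s \<le> (\<bar>y\<bar> / s) powr p"
    using assms powr_mono[of 1 p "\<bar>y\<bar> / s"] by simp
  then have "s * (\<bar>y\<bar> / s) \<le> s * (\<bar>y\<bar> powr p / s powr p)"
    using assms by (intro mult_left_mono) (auto simp: powr_divide)
  then show ?thesis
    using assms by simp
qed

lemma (in finite_measure) integrable_of_powr:
  fixes f :: "'a \<Rightarrow> real"
  assumes "1 \<le> p" "f \<in> borel_measurable M" "integrable M (\<lambda>t. \<bar>f t\<bar> powr p)"
  shows "integrable M f"
proof (rule Bochner_Integration.integrable_bound)
  show "integrable M (\<lambda>t. 1 + \<bar>f t\<bar> powr p)"
    using assms by simp
  show "AE t in M. norm (f t) \<le> norm (1 + \<bar>f t\<bar> powr p)"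
    using abs_le_add_powr[OF assms(1), of 1] by (intro AE_I2) simp
qed fact

lemma (in finite_measure) integral_abs_le_of_powr:
  fixes f :: "'a \<Rightarrow> real"
  assumes p: "1 \<le> p" and f: "f \<in> borel_measurable M" "integrable M (\<lambda>t. \<bar>f t\<bar> powr p)"
    and "0 < s" "(\<integral>t. \<bar>f t\<bar> powr p \<partial>M) \<le> s powr p"
  shows "(\<integral>t. \<bar>f t\<bar> \<partial>M) \<le> (measure M (space M) + 1) * s"
proof -
  have "(\<integral>t. \<bar>f t\<bar> \<partial>M) \<le> (\<integral>t. s + s * (\<bar>f t\<bar> powr p / s powr p) \<partial>M)"
    using integrable_of_powr[OF p f] f abs_le_add_powr[OF p \<open>0 < s\<close>]
    by (intro integral_mono) auto
  also have "\<dots> = measure M (space M) * s + s * ((\<integral>t. \<bar>f t\<bar> powr p \<partial>M) / s powr p)"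
    using f by simp
  also have "\<dots> \<le> measure M (space M) * s + s * 1"
    using assms by (intro add_left_mono mult_left_mono) auto
  finally show ?thesis
    by (simp add: algebra_simps)
qed

text \<open>The Riesz-Fischer argument. Along a subsequence the increments have summable L_1 norms,
  so it converges almost everywhere. Fatou's lemma, with the index \<open>n\<close> held fixed, then
  bounds the distance of the limit to \<open>f n\<close> for every large \<open>n\<close>, not only
  along the subsequence.\<close>

lemma (in finite_measure) powr_integral_complete:
  fixes f :: "nat \<Rightarrow> 'a \<Rightarrow> real"
  assumes p: "1 \<le> p" and meas [measurable]: "\<And>n. f n \<in> borel_measurable M"
    and int: "\<And>n. integrable M (\<lambda>t. \<bar>f n t\<bar> powr p)"
    and cauchy: "\<And>e. 0 < e \<Longrightarrow> \<exists>N. \<forall>m\<ge>N. \<forall>n\<ge>N. (\<integral>t. \<bar>f m t - f n t\<bar> powr p \<partial>M) < e"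
  obtains F where "F \<in> borel_measurable M" "integrable M (\<lambda>t. \<bar>F t\<bar> powr p)"
    "(\<lambda>n. \<integral>t. \<bar>F t - f n t\<bar> powr p \<partial>M) \<longlonglongrightarrow> 0"
proof -
  have int_diff: "integrable M (\<lambda>t. \<bar>f m t - f n t\<bar> powr p)" for m n
  proof (rule Bochner_Integration.integrable_bound)
    show "integrable M (\<lambda>t. 2 powr p * (\<bar>f m t\<bar> powr p + \<bar>f n t\<bar> powr p))"
      using int by simp
    have "\<bar>f m t - f n t\<bar> powr p \<le> 2 powr p * (\<bar>f m t\<bar> powr p + \<bar>f n t\<bar> powr p)" for t
      using abs_add_powr_le[of p "f m t" "- f n t"] p by simp
    then show "AE t in M. norm (\<bar>f m t - f n t\<bar> powr p) \<le>
        norm (2 powr p * (\<bar>f m t\<bar> powr p + \<bar>f n t\<bar> powr p))"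
      by (intro AE_I2) simp
  qed measurable
  \<comment> \<open>The p-th power of 2^(-k), so that \<open>integral_abs_le_of_powr\<close> with s
    = 2^(-k) yields a geometric bound for the L_1 norms.\<close>
  define e where "e k = ((1/2::real) ^ k) powr p" for k :: nat
  have e_pos: "0 < e k" for k
    by (simp add: e_def)
  have "\<exists>N. \<forall>k. \<forall>m\<ge>N k. \<forall>n\<ge>N k. (\<integral>t. \<bar>f m t - f n t\<bar> powr p \<partial>M) < e k"
    using cauchy[OF e_pos] by (intro choice) blast
  then obtain N where N: "\<And>k m n. N k \<le> m \<Longrightarrow> N k \<le> n \<Longrightarrow> (\<integral>t. \<bar>f m t - f n t\<bar> powr p \<partial>M) < e k"
    by blast
  \<comment> \<open>\<open>N\<close> comes from a choice and may fail to be monotone; the maximum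
    keeps \<open>r k\<close> beyond \<open>N j\<close> for all \<open>j \<le> k\<close>.\<close>
  define r where "r k = Max (N ` {..k}) + k" for k
  have N_r: "N j \<le> r k" if "j \<le> k" for j k
    unfolding r_def using that by (intro trans_le_add1 Max_ge) auto
  have r_ge: "k \<le> r k" for k
    by (simp add: r_def)
  define g where "g k t = f (r (Suc k)) t - f (r k) t" for k t
  have g_meas [measurable]: "g k \<in> borel_measurable M" for k
    unfolding g_def[abs_def] by measurable
  have g_int_powr: "integrable M (\<lambda>t. \<bar>g k t\<bar> powr p)" for k
    unfolding g_def by (rule int_diff)
  have g_bound: "(\<integral>t. \<bar>g k t\<bar> \<partial>M) \<le> (measure M (space M) + 1) * (1/2) ^ k" for k
  proof (rule integral_abs_le_of_powr[OF p g_meas g_int_powr])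
    show "(\<integral>t. \<bar>g k t\<bar> powr p \<partial>M) \<le> ((1/2) ^ k) powr p"
      using N[of k "r (Suc k)" "r k"] N_r[of k] by (simp add: g_def e_def less_imp_le)
  qed simp
  have g_int: "integrable M (\<lambda>t. \<bar>g k t\<bar>)" for k
    using integrable_of_powr[OF p g_meas g_int_powr] by simp
  have "(\<integral>\<^sup>+t. (\<Sum>k. ennreal \<bar>g k t\<bar>) \<partial>M) = (\<Sum>k. \<integral>\<^sup>+t. ennreal \<bar>g k t\<bar> \<partial>M)"
    by (intro nn_integral_suminf) measurable
  also have "\<dots> = (\<Sum>k. ennreal (\<integral>t. \<bar>g k t\<bar> \<partial>M))"
    by (intro suminf_cong nn_integral_eq_integral g_int) auto
  also have "\<dots> \<le> (\<Sum>k. ennreal ((measure M (space M) + 1) * (1/2) ^ k))"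
    by (intro suminf_le ennreal_leI g_bound) auto
  also have "\<dots> < \<infinity>"
  proof -
    have "summable (\<lambda>k. (measure M (space M) + 1) * (1/2::real) ^ k)"
      by (intro summable_mult summable_geometric) simp
    then have "(\<Sum>k. ennreal ((measure M (space M) + 1) * (1/2) ^ k)) =
        ennreal (\<Sum>k. (measure M (space M) + 1) * (1/2) ^ k)"
      by (intro suminf_ennreal2) auto
    then show ?thesis
      by simp
  qed
  finally have "AE t in M. (\<Sum>k. ennreal \<bar>g k t\<bar>) \<noteq> \<infinity>"
    by (intro nn_integral_PInf_AE) auto
  then have conv: "AE t in M. convergent (\<lambda>k. f (r k) t)"
  proof eventually_elim
    case (elim t)
    then have "summable (\<lambda>k. \<bar>g k t\<bar>)"
      by (intro summable_suminf_not_top) auto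
    then have "summable (\<lambda>k. f (r (Suc k)) t - f (r k) t)"
      unfolding g_def by (rule summable_rabs_cancel)
    then have "convergent (\<lambda>k. f (r k) t - f (r 0) t)"
      using sum_lessThan_telescope[of "\<lambda>k. f (r k) t"] by (simp add: summable_iff_convergent)
    then show ?case
      by (simp add: convergent_diff_const_right_iff)
  qed
  \<comment> \<open>The value of \<open>lim\<close> where the subsequence diverges is immaterial,
    since that set is null by \<open>conv\<close>.\<close>
  define F where "F t = lim (\<lambda>k. f (r k) t)" for t
  have [measurable]: "F \<in> borel_measurable M"
    unfolding F_def[abs_def] by measurable
  have Fatou: "(\<integral>\<^sup>+t. ennreal (\<bar>F t - f n t\<bar> powr p) \<partial>M) \<le> ennreal (e k)" if "N k \<le> n" for k n
  proof -
    have "(\<integral>\<^sup>+t. ennreal (\<bar>F t - f n t\<bar> powr p) \<partial>M)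
        \<le> (\<integral>\<^sup>+t. liminf (\<lambda>j. ennreal (\<bar>f (r j) t - f n t\<bar> powr p)) \<partial>M)"
    proof (rule nn_integral_mono_AE)
      show "AE t in M. ennreal (\<bar>F t - f n t\<bar> powr p)
          \<le> liminf (\<lambda>j. ennreal (\<bar>f (r j) t - f n t\<bar> powr p))"
        using conv
      proof eventually_elim
        case (elim t)
        then have "(\<lambda>j. f (r j) t) \<longlonglongrightarrow> F t"
          by (simp add: F_def convergent_LIMSEQ_iff)
        then have "(\<lambda>j. \<bar>f (r j) t - f n t\<bar> powr p) \<longlonglongrightarrow> \<bar>F t - f n t\<bar> powr p"
          using p by (intro tendsto_powr2 tendsto_intros) auto
        then have "(\<lambda>j. ennreal (\<bar>f (r j) t - f n t\<bar> powr p)) \<longlonglongrightarrow> ennreal (\<bar>F t - f n t\<bar> powr p)"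
          by (rule tendsto_ennrealI)
        then have "liminf (\<lambda>j. ennreal (\<bar>f (r j) t - f n t\<bar> powr p)) = ennreal (\<bar>F t - f n t\<bar> powr p)"
          by (intro lim_imp_Liminf) auto
        then show ?case
          by simp
      qed
    qed
    also have "\<dots> \<le> liminf (\<lambda>j. \<integral>\<^sup>+t. ennreal (\<bar>f (r j) t - f n t\<bar> powr p) \<partial>M)"
      by (intro nn_integral_liminf) measurable
    also have "\<dots> \<le> ennreal (e k)"
    proof (rule Liminf_le)
      show "\<forall>\<^sub>F j in sequentially. (\<integral>\<^sup>+t. ennreal (\<bar>f (r j) t - f n t\<bar> powr p) \<partial>M) \<le> ennreal (e k)"
        using eventually_ge_at_top[of k]
      proof eventually_elim
        case (elim j)
        then show ?case
          using N[OF N_r[OF elim] that] int_diff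
          by (simp add: nn_integral_eq_integral ennreal_leI less_imp_le[of "integral\<^sup>L M _"])
      qed
    qed simp
    finally show ?thesis .
  qed
  have F_int_diff: "integrable M (\<lambda>t. \<bar>F t - f n t\<bar> powr p)" if "N k \<le> n" for k n
    using Fatou[OF that] by (intro integrableI_nonneg) (auto intro: le_less_trans)
  have F_int: "integrable M (\<lambda>t. \<bar>F t\<bar> powr p)"
  proof (rule Bochner_Integration.integrable_bound)
    show "integrable M (\<lambda>t. 2 powr p * (\<bar>F t - f (N 0) t\<bar> powr p + \<bar>f (N 0) t\<bar> powr p))"
      using int F_int_diff[of 0 "N 0"] by simp
    have "\<bar>F t\<bar> powr p \<le> 2 powr p * (\<bar>F t - f (N 0) t\<bar> powr p + \<bar>f (N 0) t\<bar> powr p)" for t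
      using abs_add_powr_le[of p "F t - f (N 0) t" "f (N 0) t"] p by simp
    then show "AE t in M. norm (\<bar>F t\<bar> powr p) \<le>
        norm (2 powr p * (\<bar>F t - f (N 0) t\<bar> powr p + \<bar>f (N 0) t\<bar> powr p))"
      by (intro AE_I2) simp
  qed measurable
  have bound: "(\<integral>t. \<bar>F t - f n t\<bar> powr p \<partial>M) \<le> e k" if "N k \<le> n" for k n
    using Fatou[OF that] F_int_diff[OF that] e_pos[of k]
    by (simp add: nn_integral_eq_integral)
  have "e \<longlonglongrightarrow> 0"
    unfolding e_def[abs_def] using p by (intro tendsto_zero_powrI LIMSEQ_power_zero) auto
  have lim: "(\<lambda>n. \<integral>t. \<bar>F t - f n t\<bar> powr p \<partial>M) \<longlonglongrightarrow> 0"
  proof (rule LIMSEQ_I)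
    fix c :: real assume "0 < c"
    then obtain k where "e k < c"
      using \<open>e \<longlonglongrightarrow> 0\<close> e_pos by (auto dest!: LIMSEQ_D[where r = c] simp: less_imp_le)
    then show "\<exists>no. \<forall>n\<ge>no. norm ((\<integral>t. \<bar>F t - f n t\<bar> powr p \<partial>M) - 0) < c"
      using bound[of k] by (intro exI[of _ "N k"]) (auto intro: le_less_trans)
  qed
  show ?thesis
    by (rule that[OF _ F_int lim]) measurable
qed

section \<open>Haar expansions in the space of classes\<close>

lift_definition Lp_power :: "real \<Rightarrow> L0 \<Rightarrow> real" is
  "\<lambda>p f. \<integral>t. \<bar>f t\<bar> powr p \<partial>unit_measure"
proof -
  fix p :: real and f g :: "real \<Rightarrow> real"
  assume "ae_eq f g"
  then have [measurable]: "f \<in> borel_measurable unit_measure" "g \<in> borel_measurable unit_measure"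
    and "AE t in unit_measure. f t = g t"
    by (auto simp: ae_eq_def)
  then show "(\<integral>t. \<bar>f t\<bar> powr p \<partial>unit_measure) = (\<integral>t. \<bar>g t\<bar> powr p \<partial>unit_measure)"
    by (intro integral_cong_AE) auto
qed

text \<open>The Fourier coefficient for an orthogonal system. The denominator is there because the
  Haar functions have values 0, 1, -1 and are not normalized in L_2.\<close>

lift_definition haar_coeff :: "nat \<Rightarrow> L0 \<Rightarrow> real" is
  "\<lambda>n f. (\<integral>t. f t * haar_fun n t \<partial>unit_measure) /
    (\<integral>t. haar_fun n t * haar_fun n t \<partial>unit_measure)"
proof -
  fix n :: nat and f g :: "real \<Rightarrow> real"
  assume "ae_eq f g"
  then have [measurable]: "f \<in> borel_measurable unit_measure" "g \<in> borel_measurable unit_measure"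
    and "AE t in unit_measure. f t = g t"
    by (auto simp: ae_eq_def)
  then have "(\<integral>t. f t * haar_fun n t \<partial>unit_measure) = (\<integral>t. g t * haar_fun n t \<partial>unit_measure)"
    by (intro integral_cong_AE) auto
  then show "(\<integral>t. f t * haar_fun n t \<partial>unit_measure) /
      (\<integral>t. haar_fun n t * haar_fun n t \<partial>unit_measure) =
    (\<integral>t. g t * haar_fun n t \<partial>unit_measure) /
      (\<integral>t. haar_fun n t * haar_fun n t \<partial>unit_measure)"
    by simp
qed

lemma Lp_norm_eq: "Lp_norm p x = Lp_power p x powr (1 / p)"
  by transfer simp

lemma Lp_power_nonneg: "0 \<le> Lp_power p x"
  by transfer (simp add: integral_nonneg)

lemma Lp_power_0 [simp]: "Lp_power p 0 = 0"
  by transfer simp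

lemma Lp_norm_0 [simp]: "Lp_norm p 0 = 0"
  by (simp add: Lp_norm_eq)

lemma Lp_power_scaleR: "Lp_power p (c *\<^sub>R x) = \<bar>c\<bar> powr p * Lp_power p x"
  by transfer (simp add: abs_mult powr_mult)

lemma Lp_power_add_le:
  assumes "0 \<le> p" "x \<in> Lp p" "y \<in> Lp p"
  shows "Lp_power p (x + y) \<le> 2 powr p * (Lp_power p x + Lp_power p y)"
  using assms(2,3) unfolding Lp_def mem_Collect_eq
proof (transfer fixing: p)
  fix f g :: "real \<Rightarrow> real"
  assume fg: "ae_eq f f" "ae_eq g g"
    and int: "integrable unit_measure (\<lambda>t. \<bar>f t\<bar> powr p)"
      "integrable unit_measure (\<lambda>t. \<bar>g t\<bar> powr p)"
  then have [measurable]: "f \<in> borel_measurable unit_measure" "g \<in> borel_measurable unit_measure"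
    by (simp_all add: ae_eq_refl_iff)
  have "(\<integral>t. \<bar>f t + g t\<bar> powr p \<partial>unit_measure)
      \<le> (\<integral>t. 2 powr p * (\<bar>f t\<bar> powr p + \<bar>g t\<bar> powr p) \<partial>unit_measure)"
    using int assms(1) abs_add_powr_le[of p] by (intro integral_mono_AE') (auto intro!: AE_I2)
  then show "(\<integral>t. \<bar>f t + g t\<bar> powr p \<partial>unit_measure)
      \<le> 2 powr p * ((\<integral>t. \<bar>f t\<bar> powr p \<partial>unit_measure) + (\<integral>t. \<bar>g t\<bar> powr p \<partial>unit_measure))"
    using int by simp
qed

lemma Lp_power_eq_0_imp:
  assumes "x \<in> Lp p" "Lp_power p x = 0"
  shows "x = 0"
  using assms unfolding Lp_def mem_Collect_eq
proof (transfer fixing: p)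
  fix f :: "real \<Rightarrow> real"
  assume "ae_eq f f" "integrable unit_measure (\<lambda>t. \<bar>f t\<bar> powr p)"
    "(\<integral>t. \<bar>f t\<bar> powr p \<partial>unit_measure) = 0"
  then have "AE t in unit_measure. \<bar>f t\<bar> powr p = 0"
    by (subst (asm) integral_nonneg_eq_0_iff_AE) auto
  then have "AE t in unit_measure. f t = 0"
    by eventually_elim simp
  with \<open>ae_eq f f\<close> show "ae_eq f (\<lambda>t. 0)"
    by (simp add: ae_eq_def)
qed

lemma Lp_norm_tendsto_0_iff:
  assumes "0 < p"
  shows "(\<lambda>n. Lp_norm p (X n)) \<longlonglongrightarrow> 0 \<longleftrightarrow> (\<lambda>n. Lp_power p (X n)) \<longlonglongrightarrow> 0"
proof
  assume "(\<lambda>n. Lp_norm p (X n)) \<longlonglongrightarrow> 0"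
  then have "(\<lambda>n. Lp_norm p (X n) powr p) \<longlonglongrightarrow> 0"
    using assms by (intro tendsto_zero_powrI[OF _ tendsto_const]) (auto simp: Lp_norm_eq)
  then show "(\<lambda>n. Lp_power p (X n)) \<longlonglongrightarrow> 0"
    using assms by (simp add: Lp_norm_eq powr_powr Lp_power_nonneg)
next
  assume "(\<lambda>n. Lp_power p (X n)) \<longlonglongrightarrow> 0"
  then show "(\<lambda>n. Lp_norm p (X n)) \<longlonglongrightarrow> 0"
    unfolding Lp_norm_eq using assms
    by (intro tendsto_zero_powrI[OF _ tendsto_const]) (auto simp: Lp_power_nonneg)
qed

lemma Lp_complete:
  assumes p: "1 \<le> p" and X: "\<And>n. X n \<in> Lp p"
    and cauchy: "\<And>e. 0 < e \<Longrightarrow> \<exists>N. \<forall>m\<ge>N. \<forall>n\<ge>N. Lp_power p (X m - X n) < e"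
  obtains x where "x \<in> Lp p" "(\<lambda>n. Lp_power p (x - X n)) \<longlonglongrightarrow> 0"
proof -
  have "\<exists>f. ae_eq f f \<and> abs_L0 f = x" for x
    by (induction x rule: L0.abs_induct) blast
  then have "\<forall>n. \<exists>f. ae_eq f f \<and> X n = abs_L0 f"
    by metis
  from choice[OF this] obtain f where f: "\<And>n. ae_eq (f n) (f n)" "\<And>n. X n = abs_L0 (f n)"
    by blast
  then have [measurable]: "f n \<in> borel_measurable unit_measure" for n
    by (simp add: ae_eq_refl_iff)
  have diff: "abs_L0 g - abs_L0 h = abs_L0 (\<lambda>t. g t - h t)" "ae_eq (\<lambda>t. g t - h t) (\<lambda>t. g t - h t)"
    if "ae_eq g g" "ae_eq h h" for g h
    using that by (simp_all add: minus_L0.abs_eq ae_eq_refl_iff)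
  obtain F where F [measurable]: "F \<in> borel_measurable unit_measure"
      "integrable unit_measure (\<lambda>t. \<bar>F t\<bar> powr p)"
      "(\<lambda>n. \<integral>t. \<bar>F t - f n t\<bar> powr p \<partial>unit_measure) \<longlonglongrightarrow> 0"
  proof (rule finite_measure.powr_integral_complete[OF finite_measure_unit p, of f])
    show "integrable unit_measure (\<lambda>t. \<bar>f n t\<bar> powr p)" for n
      using X[of n] unfolding Lp_def mem_Collect_eq f(2) Lp_mem.abs_eq[OF f(1)] .
    show "\<exists>N. \<forall>m\<ge>N. \<forall>n\<ge>N. (\<integral>t. \<bar>f m t - f n t\<bar> powr p \<partial>unit_measure) < e" if "0 < e" for e
      using cauchy[OF that] by (simp add: f diff Lp_power.abs_eq)
  qed auto
  have F': "ae_eq F F"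
    by (simp add: ae_eq_refl_iff F)
  show ?thesis
  proof (rule that[of "abs_L0 F"])
    show "abs_L0 F \<in> Lp p"
      using F(2) by (simp add: Lp_def Lp_mem.abs_eq F')
    show "(\<lambda>n. Lp_power p (abs_L0 F - X n)) \<longlonglongrightarrow> 0"
      using F(3) by (simp add: f F' diff Lp_power.abs_eq)
  qed
qed

lemma Lp_integrable:
  assumes "1 \<le> p" "ae_eq f f" "integrable unit_measure (\<lambda>t. \<bar>f t\<bar> powr p)"
  shows "integrable unit_measure (\<lambda>t. f t * haar_fun n t)"
proof (rule Bochner_Integration.integrable_bound)
  have meas [measurable]: "f \<in> borel_measurable unit_measure"
    using assms by (simp add: ae_eq_refl_iff)
  show "integrable unit_measure f"
    by (rule finite_measure.integrable_of_powr[OF finite_measure_unit assms(1) meas assms(3)])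
  show "(\<lambda>t. f t * haar_fun n t) \<in> borel_measurable unit_measure"
    by measurable
  show "AE t in unit_measure. norm (f t * haar_fun n t) \<le> norm (f t)"
    by (intro AE_I2) (simp add: abs_mult mult_left_le haar_fun_le_1)
qed

lemma haar_coeff_add:
  assumes "1 \<le> p" "x \<in> Lp p" "y \<in> Lp p"
  shows "haar_coeff n (x + y) = haar_coeff n x + haar_coeff n y"
  using assms(2,3) unfolding Lp_def mem_Collect_eq
  by (transfer fixing: p)
    (simp add: distrib_right Lp_integrable[OF assms(1)] add_divide_distrib)

lemma haar_coeff_scaleR: "haar_coeff n (c *\<^sub>R x) = c * haar_coeff n x"
  by transfer (simp add: mult.assoc)

text \<open>Since the Haar functions are bounded by 1, the coefficient is controlled by the L_1
  norm, hence by the L_p norm through \<open>integral_abs_le_of_powr\<close>. That estimate asks for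
  a positive \<open>s\<close>, so the zero element is treated apart. Boundedness lets coefficients
  pass to limits and puts their negatives into the dual space.\<close>

lemma haar_coeff_bounded:
  assumes p: "1 \<le> p"
  shows "\<exists>K. \<forall>x\<in>Lp p. \<bar>haar_coeff n x\<bar> \<le> K * Lp_norm p x"
proof -
  let ?d = "\<integral>t. haar_fun n t * haar_fun n t \<partial>unit_measure"
  let ?m = "measure unit_measure {0..1} + 1"
  have bound: "\<bar>haar_coeff n x\<bar> \<le> ?m / \<bar>?d\<bar> * s"
    if "x \<in> Lp p" "0 < s" "Lp_power p x \<le> s powr p" for x s
    using that unfolding Lp_def mem_Collect_eq
  proof (transfer fixing: p s n)
    fix f :: "real \<Rightarrow> real"
    assume f: "ae_eq f f" "integrable unit_measure (\<lambda>t. \<bar>f t\<bar> powr p)"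
      and s: "0 < s" "(\<integral>t. \<bar>f t\<bar> powr p \<partial>unit_measure) \<le> s powr p"
    have meas: "f \<in> borel_measurable unit_measure"
      using f by (simp add: ae_eq_refl_iff)
    have "\<bar>\<integral>t. f t * haar_fun n t \<partial>unit_measure\<bar> \<le> (\<integral>t. \<bar>f t * haar_fun n t\<bar> \<partial>unit_measure)"
      by (rule integral_abs_bound)
    also have "\<dots> \<le> (\<integral>t. \<bar>f t\<bar> \<partial>unit_measure)"
    proof (rule integral_mono)
      show "integrable unit_measure (\<lambda>t. \<bar>f t * haar_fun n t\<bar>)"
        by (rule integrable_abs[OF Lp_integrable[OF p f]])
      show "integrable unit_measure (\<lambda>t. \<bar>f t\<bar>)"
        by (rule integrable_abs[OF finite_measure.integrable_of_powr[OF finite_measure_unit p meas f(2)]])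
      show "\<bar>f t * haar_fun n t\<bar> \<le> \<bar>f t\<bar>" for t
        by (simp add: abs_mult mult_left_le haar_fun_le_1)
    qed
    also have "\<dots> \<le> ?m * s"
      using finite_measure.integral_abs_le_of_powr[OF finite_measure_unit p meas f(2) s] by simp
    finally show "\<bar>(\<integral>t. f t * haar_fun n t \<partial>unit_measure) / ?d\<bar> \<le> ?m / \<bar>?d\<bar> * s"
      by (simp add: abs_divide divide_right_mono)
  qed
  show ?thesis
  proof (intro exI ballI)
    fix x assume x: "x \<in> Lp p"
    show "\<bar>haar_coeff n x\<bar> \<le> ?m / \<bar>?d\<bar> * Lp_norm p x"
    proof (cases "Lp_power p x = 0")
      case True
      then have "x = 0"
        using x Lp_power_eq_0_imp by blast
      then show ?thesis
        using haar_coeff_scaleR[of n 0 0] by simp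
    next
      case False
      then have "0 < Lp_power p x"
        using Lp_power_nonneg[of p x] by simp
      then show ?thesis
        using bound[OF x, of "Lp_norm p x"] p by (simp add: Lp_norm_eq powr_powr)
    qed
  qed
qed

lemma haar_coeff_haar:
  assumes "1 \<le> m" "1 \<le> n"
  shows "haar_coeff n (haar m) = (if m = n then 1 else 0)"
proof -
  have "haar_coeff n (haar m) = (\<integral>t. haar_fun m t * haar_fun n t \<partial>unit_measure) /
      (\<integral>t. haar_fun n t * haar_fun n t \<partial>unit_measure)"
    by transfer simp
  then show ?thesis
    using integral_haar_orthogonal[OF assms] integral_haar_square_pos[OF assms(2)] by auto
qed

section \<open>Partial sums and convergent Haar series\<close>

definition haar_partial_sum :: "(nat \<Rightarrow> real) \<Rightarrow> nat \<Rightarrow> L0" where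
  "haar_partial_sum a N = (\<Sum>n = 1..N. a n *\<^sub>R haar n)"

lemma haar_partial_sum_eq_abs: "haar_partial_sum a N = abs_L0 (haar_sum a N)"
proof (induction N)
  case 0
  show ?case
    by (simp add: haar_partial_sum_def haar_sum_def[abs_def] zero_L0_def)
next
  case (Suc N)
  have ae: "ae_eq (haar_sum a N) (haar_sum a N)" "ae_eq (haar_fun n) (haar_fun n)"
    "ae_eq (\<lambda>t. c * haar_fun n t) (\<lambda>t. c * haar_fun n t)" for n c
    by (simp_all add: ae_eq_refl_iff)
  have "haar_partial_sum a (Suc N) = abs_L0 (haar_sum a N) + a (Suc N) *\<^sub>R abs_L0 (haar_fun (Suc N))"
    using Suc by (simp add: haar_partial_sum_def haar_def)
  also have "\<dots> = abs_L0 (\<lambda>t. haar_sum a N t + a (Suc N) * haar_fun (Suc N) t)"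
    by (simp add: scaleR_L0.abs_eq plus_L0.abs_eq ae)
  finally show ?case
    by (simp add: haar_sum_Suc[abs_def])
qed

lemma Lp_power_haar_partial_sum:
  "Lp_power p (haar_partial_sum a N) = (\<integral>t. \<bar>haar_sum a N t\<bar> powr p \<partial>unit_measure)"
  unfolding haar_partial_sum_eq_abs by (simp add: Lp_power.abs_eq ae_eq_refl_iff)

lemma haar_partial_sum_in_Lp:
  assumes "0 < p"
  shows "haar_partial_sum a N \<in> Lp p"
  unfolding haar_partial_sum_def
  by (intro subspace_sum subspace_scale subspace_Lp assms haar_in_Lp)

lemma haar_coeff_partial_sum:
  assumes "1 \<le> n"
  shows "haar_coeff n (haar_partial_sum a N) = (if n \<le> N then a n else 0)"
proof (induction N)
  case 0
  show ?case
    using assms haar_coeff_scaleR[of n 0 0] by (simp add: haar_partial_sum_def)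
next
  case (Suc N)
  have "haar_partial_sum a (Suc N) = haar_partial_sum a N + a (Suc N) *\<^sub>R haar (Suc N)"
    by (simp add: haar_partial_sum_def)
  \<comment> \<open>The statement carries no exponent, so additivity is taken from
    \<open>Lp 1\<close>, which contains all partial sums.\<close>
  moreover have "haar_coeff n (haar_partial_sum a N + a (Suc N) *\<^sub>R haar (Suc N)) =
      haar_coeff n (haar_partial_sum a N) + a (Suc N) * haar_coeff n (haar (Suc N))"
    using assms by (subst haar_coeff_add[of 1])
      (auto simp: haar_coeff_scaleR haar_partial_sum_in_Lp subspace_scale subspace_Lp haar_in_Lp)
  moreover have "haar_coeff n (haar (Suc N)) = (if Suc N = n then 1 else 0)"
    using assms by (intro haar_coeff_haar) auto
  ultimately show ?case
    using Suc by (auto simp: le_Suc_eq)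
qed

text \<open>Not the linear span: these are the elements of L_p that are the norm limit of their own
  Haar series.\<close>

definition haar_span :: "real \<Rightarrow> L0 set" where
  "haar_span p = {x \<in> Lp p.
     (\<lambda>N. Lp_power p (x - haar_partial_sum (\<lambda>n. haar_coeff n x) N)) \<longlonglongrightarrow> 0}"

lemma haar_partial_sum_cong:
  "(\<And>n. 1 \<le> n \<Longrightarrow> a n = b n) \<Longrightarrow> haar_partial_sum a N = haar_partial_sum b N"
  by (simp add: haar_partial_sum_def)

lemma haar_partial_sum_add:
  "haar_partial_sum a N + haar_partial_sum b N = haar_partial_sum (\<lambda>n. a n + b n) N"
  by (simp add: haar_partial_sum_def sum.distrib scaleR_add_left)

lemma haar_partial_sum_scaleR: "c *\<^sub>R haar_partial_sum a N = haar_partial_sum (\<lambda>n. c * a n) N"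
  by (simp add: haar_partial_sum_def scaleR_sum_right)

lemma haar_partial_sum_diff:
  "haar_partial_sum a N - haar_partial_sum b N = haar_partial_sum (\<lambda>n. a n - b n) N"
  by (simp add: haar_partial_sum_def sum_subtractf scaleR_diff_left)

lemma Lp_diff: "0 < p \<Longrightarrow> x \<in> Lp p \<Longrightarrow> y \<in> Lp p \<Longrightarrow> x - y \<in> Lp p"
  by (intro subspace_diff subspace_Lp)

lemma haar_coeff_diff:
  assumes "1 \<le> p" "x \<in> Lp p" "y \<in> Lp p"
  shows "haar_coeff n (x - y) = haar_coeff n x - haar_coeff n y"
  using haar_coeff_add[OF assms(1), of "x - y" y n] assms by (simp add: Lp_diff)

text \<open>The \<open>n\<close>-th coefficient functional is continuous, and on the partial sums it
  equals \<open>a n\<close> as soon as \<open>n \<le> N\<close>.\<close>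

lemma haar_expansion_coeff:
  assumes p: "1 \<le> p" and x: "x \<in> Lp p"
    and lim: "(\<lambda>N. Lp_power p (x - haar_partial_sum a N)) \<longlonglongrightarrow> 0" and n: "1 \<le> n"
  shows "haar_coeff n x = a n"
proof -
  obtain K where K: "\<And>y. y \<in> Lp p \<Longrightarrow> \<bar>haar_coeff n y\<bar> \<le> K * Lp_norm p y"
    using haar_coeff_bounded[OF p] by blast
  have "(\<lambda>N. K * Lp_norm p (x - haar_partial_sum a N)) \<longlonglongrightarrow> K * 0"
    using lim p by (intro tendsto_mult tendsto_const) (simp add: Lp_norm_tendsto_0_iff)
  then have K_lim: "(\<lambda>N. K * Lp_norm p (x - haar_partial_sum a N)) \<longlonglongrightarrow> 0"
    by simp
  have "x - haar_partial_sum a N \<in> Lp p" for N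
    using x p by (simp add: Lp_diff haar_partial_sum_in_Lp)
  then have "\<forall>N. norm (haar_coeff n (x - haar_partial_sum a N)) \<le> K * Lp_norm p (x - haar_partial_sum a N)"
    using K by simp
  then have "(\<lambda>N. haar_coeff n (x - haar_partial_sum a N)) \<longlonglongrightarrow> 0"
    by (rule Lim_null_comparison[OF always_eventually K_lim])
  moreover have "\<forall>\<^sub>F N in sequentially. haar_coeff n (x - haar_partial_sum a N) = haar_coeff n x - a n"
    using eventually_ge_at_top[of n]
  proof eventually_elim
    case (elim N)
    then show ?case
      using p x n by (simp add: haar_coeff_diff[OF p] haar_partial_sum_in_Lp haar_coeff_partial_sum)
  qed
  ultimately have "(\<lambda>N. haar_coeff n x - a n) \<longlonglongrightarrow> 0"
    by (rule Lim_transform_eventually)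
  then show ?thesis
    by (simp add: LIMSEQ_const_iff)
qed

lemma haar_span_iff:
  assumes "1 \<le> p"
  shows "x \<in> haar_span p \<and> (\<forall>n\<ge>1. haar_coeff n x = a n) \<longleftrightarrow>
    x \<in> Lp p \<and> (\<lambda>N. Lp_power p (x - haar_partial_sum a N)) \<longlonglongrightarrow> 0"
proof -
  have "haar_partial_sum (\<lambda>n. haar_coeff n x) = haar_partial_sum a" if "\<forall>n\<ge>1. haar_coeff n x = a n"
    using that by (intro ext haar_partial_sum_cong) simp
  then show ?thesis
    unfolding haar_span_def mem_Collect_eq using haar_expansion_coeff[OF assms] by metis
qed

text \<open>The sequence quantified existentially in the definition of the cone is forced to be the
  coefficient sequence. Membership thereby becomes a condition on coordinates.\<close>

lemma haar_cone_eq: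
  assumes "1 \<le> p"
  shows "haar_cone p = {x \<in> haar_span p. \<forall>n\<ge>1. 0 \<le> haar_coeff n x}"
proof -
  have "x \<in> haar_cone p \<longleftrightarrow> (\<exists>a. (\<forall>n\<ge>1. 0 \<le> a n) \<and> x \<in> haar_span p \<and> (\<forall>n\<ge>1. haar_coeff n x = a n))" for x
    using assms unfolding haar_span_iff[OF assms] haar_cone_def haar_partial_sum_def[symmetric]
    by (auto simp: Lp_norm_tendsto_0_iff)
  moreover have "(\<exists>a. (\<forall>n\<ge>1. 0 \<le> a n) \<and> x \<in> haar_span p \<and> (\<forall>n\<ge>1. haar_coeff n x = a n)) \<longleftrightarrow>
      x \<in> haar_span p \<and> (\<forall>n\<ge>1. 0 \<le> haar_coeff n x)" for x
    by (intro iffI; (elim exE conjE)?; (intro exI[of _ "\<lambda>n. haar_coeff n x"])?) simp_all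
  ultimately show ?thesis
    by (intro set_eqI) (simp only: mem_Collect_eq)
qed

lemma subspace_haar_span:
  assumes p: "1 \<le> p"
  shows "subspace (haar_span p)"
proof (rule subspaceI)
  have "haar_coeff n 0 = 0" for n
    using haar_coeff_scaleR[of n 0 0] by simp
  then show "0 \<in> haar_span p"
    using subspace_0[OF subspace_Lp] p by (simp add: haar_span_def haar_partial_sum_def)
next
  fix x y assume xy: "x \<in> haar_span p" "y \<in> haar_span p"
  let ?S = "\<lambda>x N. haar_partial_sum (\<lambda>n. haar_coeff n x) N"
  have L: "x \<in> Lp p" "y \<in> Lp p"
    using xy by (auto simp: haar_span_def)
  have S: "?S (x + y) N = ?S x N + ?S y N" for N
    by (simp add: haar_partial_sum_add haar_coeff_add[OF p L])
  have "(\<lambda>N. 2 powr p * (Lp_power p (x - ?S x N) + Lp_power p (y - ?S y N))) \<longlonglongrightarrow> 2 powr p * (0 + 0)"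
    using xy by (intro tendsto_intros) (auto simp: haar_span_def)
  then have upper: "(\<lambda>N. 2 powr p * (Lp_power p (x - ?S x N) + Lp_power p (y - ?S y N))) \<longlonglongrightarrow> 0"
    by simp
  have "norm (Lp_power p (x + y - ?S (x + y) N)) \<le>
      2 powr p * (Lp_power p (x - ?S x N) + Lp_power p (y - ?S y N))" for N
    using Lp_power_add_le[of p "x - ?S x N" "y - ?S y N"] p L
    by (simp add: S Lp_diff haar_partial_sum_in_Lp add_diff_add Lp_power_nonneg)
  then have "(\<lambda>N. Lp_power p (x + y - ?S (x + y) N)) \<longlonglongrightarrow> 0"
    by (intro Lim_null_comparison[OF always_eventually upper]) blast
  then show "x + y \<in> haar_span p"
    using L p by (simp add: haar_span_def subspace_add[OF subspace_Lp])
next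
  fix c x assume x: "x \<in> haar_span p"
  let ?S = "\<lambda>x N. haar_partial_sum (\<lambda>n. haar_coeff n x) N"
  have "c *\<^sub>R x - ?S (c *\<^sub>R x) N = c *\<^sub>R (x - ?S x N)" for N
    by (simp add: haar_coeff_scaleR scaleR_diff_right haar_partial_sum_scaleR)
  moreover have "(\<lambda>N. \<bar>c\<bar> powr p * Lp_power p (x - ?S x N)) \<longlonglongrightarrow> \<bar>c\<bar> powr p * 0"
    using x by (intro tendsto_intros) (auto simp: haar_span_def)
  ultimately show "c *\<^sub>R x \<in> haar_span p"
    using x p by (simp add: haar_span_def Lp_power_scaleR subspace_scale[OF subspace_Lp])
qed

lemma haar_span_eqI:
  assumes p: "1 \<le> p" and "x \<in> haar_span p" "y \<in> haar_span p"
    and eq: "\<And>n. 1 \<le> n \<Longrightarrow> haar_coeff n x = haar_coeff n y"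
  shows "x = y"
proof -
  have L: "x \<in> Lp p" "y \<in> Lp p"
    using assms by (auto simp: haar_span_def)
  have "x - y \<in> haar_span p"
    using assms by (intro subspace_diff subspace_haar_span)
  moreover have "haar_partial_sum (\<lambda>n. haar_coeff n (x - y)) N = 0" for N
    unfolding haar_partial_sum_def by (rule sum.neutral) (simp add: haar_coeff_diff[OF p L] eq)
  ultimately have "(\<lambda>N. Lp_power p (x - y)) \<longlonglongrightarrow> 0"
    by (simp add: haar_span_def)
  then have "Lp_power p (x - y) = 0"
    by (simp add: LIMSEQ_const_iff)
  then have "x - y = 0"
    using p L by (intro Lp_power_eq_0_imp[of _ p] Lp_diff) auto
  then show ?thesis
    by simp
qed

text \<open>The differences of partial sums of the multiplied series are multiplier images of those
  of the series of \<open>u\<close>. With the uniform constant \<open>K\<close> they are again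
  Cauchy, and completeness provides \<open>y\<close>.\<close>

lemma haar_span_multiplier:
  assumes p: "1 < p" and u: "u \<in> haar_span p" and b: "\<And>n. \<bar>b n\<bar> \<le> (1::real)"
  shows "\<exists>y\<in>haar_span p. \<forall>n\<ge>1. haar_coeff n y = b n * haar_coeff n u"
proof -
  obtain K where K: "0 \<le> K" "\<And>a b N. (\<And>n. \<bar>b n\<bar> \<le> (1::real)) \<Longrightarrow>
      Lp_power p (haar_partial_sum (\<lambda>n. b n * a n) N) \<le> K * Lp_power p (haar_partial_sum a N)"
    using haar_unconditional[OF p] unfolding Lp_power_haar_partial_sum by blast
  define a where "a = (\<lambda>n. haar_coeff n u)"
  have uL: "u \<in> Lp p" and lim: "(\<lambda>N. Lp_power p (u - haar_partial_sum a N)) \<longlonglongrightarrow> 0"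
    using u by (auto simp: haar_span_def a_def)
  let ?S = "haar_partial_sum a" and ?Y = "haar_partial_sum (\<lambda>n. b n * a n)"
  \<comment> \<open>A difference of partial sums is itself a partial sum, with the first
    \<open>M\<close> coefficients set to 0, so the multiplier bound applies to it.\<close>
  have tail: "haar_partial_sum c N - haar_partial_sum c M =
      haar_partial_sum (\<lambda>n. if M < n then c n else 0) N" if "M \<le> N" for c :: "nat \<Rightarrow> real" and M N
  proof -
    have "haar_partial_sum c M = haar_partial_sum (\<lambda>n. if n \<le> M then c n else 0) N"
      unfolding haar_partial_sum_def using that
      by (intro sum.mono_neutral_cong_left) auto
    then show ?thesis
      unfolding haar_partial_sum_diff[symmetric] by (simp add: haar_partial_sum_diff)
        (auto intro!: haar_partial_sum_cong)
  qed
  have le: "Lp_power p (?Y N - ?Y M) \<le> K * Lp_power p (?S N - ?S M)" if "M \<le> N" for M N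
  proof -
    have "(\<lambda>n. if M < n then b n * a n else 0) = (\<lambda>n. b n * (if M < n then a n else 0))"
      by auto
    then show ?thesis
      unfolding tail[OF that] using K(2)[OF b] by simp
  qed
  have split: "Lp_power p (?S N - ?S M) \<le>
      2 powr p * (Lp_power p (u - ?S M) + Lp_power p (u - ?S N))" for M N
  proof -
    have "?S N - ?S M = (u - ?S M) + (-1) *\<^sub>R (u - ?S N)"
      by simp
    then show ?thesis
      using Lp_power_add_le[of p "u - ?S M" "(-1) *\<^sub>R (u - ?S N)"] p uL
      by (simp only: Lp_power_scaleR) (simp add: Lp_diff haar_partial_sum_in_Lp)
  qed
  have Y_le: "Lp_power p (?Y m - ?Y n) \<le>
      K * (2 powr p * (Lp_power p (u - ?S m) + Lp_power p (u - ?S n)))" for m n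
  proof -
    \<comment> \<open>\<open>le\<close> wants ordered indices; symmetry reduces arbitrary ones to
      their minimum and maximum.\<close>
    have "Lp_power p (?Y m - ?Y n) = Lp_power p (?Y n - ?Y m)" for m n
      using Lp_power_scaleR[of p "-1" "?Y n - ?Y m"] by simp
    then have "Lp_power p (?Y m - ?Y n) = Lp_power p (?Y (max m n) - ?Y (min m n))"
      by (auto simp: max_def min_def)
    also have "\<dots> \<le> K * Lp_power p (?S (max m n) - ?S (min m n))"
      by (intro le) simp
    also have "\<dots> \<le> K * (2 powr p * (Lp_power p (u - ?S (min m n)) + Lp_power p (u - ?S (max m n))))"
      by (intro mult_left_mono split K)
    also have "\<dots> = K * (2 powr p * (Lp_power p (u - ?S m) + Lp_power p (u - ?S n)))"
      by (simp add: max_def min_def add.commute)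
    finally show ?thesis .
  qed
  obtain y where y: "y \<in> Lp p" "(\<lambda>N. Lp_power p (y - ?Y N)) \<longlonglongrightarrow> 0"
  proof (rule Lp_complete[of p ?Y])
    fix e :: real assume "0 < e"
    have "(\<lambda>N. K * (2 powr p * (2 * Lp_power p (u - ?S N)))) \<longlonglongrightarrow> K * (2 powr p * (2 * 0))"
      using lim by (intro tendsto_intros)
    then obtain N where N: "\<And>n. N \<le> n \<Longrightarrow> K * (2 powr p * (2 * Lp_power p (u - ?S n))) < e"
      using \<open>0 < e\<close> order_tendstoD(2)[of _ _ sequentially e]
      by (fastforce simp: eventually_sequentially)
    have "Lp_power p (?Y m - ?Y n) < e" if "N \<le> m" "N \<le> n" for m n
      using Y_le[of m n] N[OF that(1)] N[OF that(2)] by (simp add: distrib_left)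
    then show "\<exists>N. \<forall>m\<ge>N. \<forall>n\<ge>N. Lp_power p (?Y m - ?Y n) < e"
      by blast
  qed (use p in \<open>auto simp: haar_partial_sum_in_Lp\<close>)
  then show ?thesis
    using haar_span_iff[of p y "\<lambda>n. b n * a n"] p by (auto simp: a_def)
qed

section \<open>Nonsupport points of the Haar cone\<close>

lemma nonsupport_haar_coeff_pos:
  assumes p: "1 < p" and u: "u \<in> nonsupport_points (Lp p) (Lp_norm p) (haar_cone p)" and n: "1 \<le> n"
  shows "0 < haar_coeff n u"
proof (rule ccontr)
  assume "\<not> 0 < haar_coeff n u"
  moreover have cone: "haar_cone p = {x \<in> haar_span p. \<forall>n\<ge>1. 0 \<le> haar_coeff n x}"
    using p by (intro haar_cone_eq) simp
  moreover have uC: "u \<in> haar_cone p"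
    using u by (simp add: nonsupport_points_def)
  ultimately have "haar_coeff n u = 0"
    using n by force
  let ?\<phi> = "\<lambda>x. - haar_coeff n x"
  obtain K where "\<And>x. x \<in> Lp p \<Longrightarrow> \<bar>haar_coeff n x\<bar> \<le> K * Lp_norm p x"
    using haar_coeff_bounded[of p n] p by auto
  then have dual: "?\<phi> \<in> dual_space (Lp p) (Lp_norm p)"
    using p by (auto simp: dual_space_def haar_coeff_add[of p] haar_coeff_scaleR)
  have nonzero: "\<exists>v\<in>Lp p. ?\<phi> v \<noteq> 0"
    using n by (intro bexI[of _ "haar n"] haar_in_Lp) (simp add: haar_coeff_haar)
  have max: "?\<phi> y \<le> ?\<phi> u" if "y \<in> haar_cone p" for y
    using that n \<open>haar_coeff n u = 0\<close> by (simp add: cone)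
  have "support_point (Lp p) (Lp_norm p) (haar_cone p) u"
    unfolding support_point_def
    by (intro conjI uC bexI[OF _ dual] nonzero ballI max)
  with u show False
    by (simp add: nonsupport_points_def)
qed

section \<open>The order unit space\<close>

text \<open>The order-theoretic part for a cone given by nonnegative coordinates \<open>c n\<close>
  that separate the points of \<open>D\<close>. The analysis enters through
  \<open>multiplier\<close> alone, which yields surjectivity.\<close>

lemma unit_space_linearly_isometric_l_infinity:
  fixes c :: "nat \<Rightarrow> 'a::real_vector \<Rightarrow> real"
  assumes D: "subspace D" "D \<subseteq> V"
    and add: "\<And>n x y. x \<in> D \<Longrightarrow> y \<in> D \<Longrightarrow> c n (x + y) = c n x + c n y"
    and scale: "\<And>n r x. x \<in> D \<Longrightarrow> c n (r *\<^sub>R x) = r * c n x"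
    and unique: "\<And>x y. x \<in> D \<Longrightarrow> y \<in> D \<Longrightarrow> (\<And>n. c n x = c n y) \<Longrightarrow> x = y"
    and C: "C = {x \<in> D. \<forall>n. 0 \<le> c n x}"
    and u: "u \<in> D" "\<And>n. 0 < c n u"
    and multiplier: "\<And>b. (\<And>n. \<bar>b n\<bar> \<le> 1) \<Longrightarrow> \<exists>y\<in>D. \<forall>n. c n y = b n * c n u"
  shows "linearly_isometric (unit_space C u) (unit_norm V C u) (UNIV :: l_infinity set) norm"
proof -
  have minus: "c n (- x) = - c n x" if "x \<in> D" for n x
    using scale[OF that, of n "-1"] by simp
  have diff: "c n (x - y) = c n x - c n y" if "x \<in> D" "y \<in> D" for n x y
    using add[OF that(1) subspace_neg[OF D(1) that(2)], of n] minus[OF that(2)] by simp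
  note D_simps = subspace_add[OF D(1)] subspace_diff[OF D(1)] subspace_neg[OF D(1)]
    subspace_scale[OF D(1)]
  have interval_iff: "x \<in> (\<lambda>y. l *\<^sub>R y) ` sym_interval V C u \<longleftrightarrow>
      x \<in> D \<and> (\<forall>n. \<bar>c n x\<bar> \<le> l * c n u)" if "0 < l" for x l
  proof -
    have sym: "y \<in> sym_interval V C u \<longleftrightarrow> y \<in> D \<and> (\<forall>n. \<bar>c n y\<bar> \<le> c n u)" for y
    proof -
      have "y \<in> sym_interval V C u \<longleftrightarrow> y \<in> V \<and> y + u \<in> C \<and> u - y \<in> C"
        by (simp add: sym_interval_def cone_le_def)
      \<comment> \<open>The interval is formed in \<open>V\<close>, but \<open>y + u\<close> and
        \<open>u\<close> lie in \<open>D\<close>, so \<open>y\<close> does too.\<close>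
      also have "\<dots> \<longleftrightarrow> y \<in> D \<and> y + u \<in> C \<and> u - y \<in> C"
        using subspace_diff[OF D(1), of "y + u" u] u D(2) by (auto simp: C)
      also have "\<dots> \<longleftrightarrow> y \<in> D \<and> (\<forall>n. 0 \<le> c n y + c n u \<and> 0 \<le> c n u - c n y)"
        using u by (auto simp: C add diff D_simps)
      also have "\<dots> \<longleftrightarrow> y \<in> D \<and> (\<forall>n. \<bar>c n y\<bar> \<le> c n u)"
        by (intro conj_cong refl all_cong1) linarith
      finally show ?thesis .
    qed
    show ?thesis
    proof
      assume "x \<in> (\<lambda>y. l *\<^sub>R y) ` sym_interval V C u"
      then obtain y where "x = l *\<^sub>R y" "y \<in> sym_interval V C u"
        by (rule imageE)
      then show "x \<in> D \<and> (\<forall>n. \<bar>c n x\<bar> \<le> l * c n u)"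
        using that by (auto simp: sym scale D_simps abs_mult)
    next
      assume x: "x \<in> D \<and> (\<forall>n. \<bar>c n x\<bar> \<le> l * c n u)"
      then have "(1 / l) *\<^sub>R x \<in> sym_interval V C u"
        using that by (simp add: sym scale D_simps abs_mult field_simps)
      moreover have "x = l *\<^sub>R ((1 / l) *\<^sub>R x)"
        using that by simp
      ultimately show "x \<in> (\<lambda>y. l *\<^sub>R y) ` sym_interval V C u"
        by blast
    qed
  qed
  have generated_iff: "x \<in> generated_cone C u \<longleftrightarrow> x \<in> D \<and> (\<exists>l>0. \<forall>n. - l * c n u \<le> c n x)" for x
  proof
    assume "x \<in> generated_cone C u"
    then obtain l y where ly: "x = l *\<^sub>R (y - u)" "0 < l" "y \<in> C"
      by (auto simp: generated_cone_def)
    then have "y \<in> D" "\<And>n. 0 \<le> c n y"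
      by (auto simp: C)
    then have "- l * c n u \<le> c n x" for n
      using ly u mult_nonneg_nonneg[of l "c n y"]
      by (simp add: scale diff D_simps right_diff_distrib)
    then show "x \<in> D \<and> (\<exists>l>0. \<forall>n. - l * c n u \<le> c n x)"
      using ly u \<open>y \<in> D\<close> by (auto simp: D_simps)
  next
    assume "x \<in> D \<and> (\<exists>l>0. \<forall>n. - l * c n u \<le> c n x)"
    then obtain l where l: "x \<in> D" "0 < l" "\<And>n. - l * c n u \<le> c n x"
      by blast
    have "0 \<le> c n ((1 / l) *\<^sub>R x + u)" for n
    proof -
      have "0 \<le> (c n x + l * c n u) / l"
        using l(2) l(3)[of n] by (intro divide_nonneg_pos) auto
      then show ?thesis
        using l u by (simp add: add scale D_simps add_divide_distrib)
    qed
    then have "(1 / l) *\<^sub>R x + u \<in> C"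
      using l u by (simp add: C D_simps)
    moreover have "x = l *\<^sub>R (((1 / l) *\<^sub>R x + u) - u)"
      using l by simp
    ultimately show "x \<in> generated_cone C u"
      using l(2) unfolding generated_cone_def by blast
  qed
  have unit_iff: "x \<in> unit_space C u \<longleftrightarrow> x \<in> D \<and> (\<exists>l. \<forall>n. \<bar>c n x\<bar> \<le> l * c n u)" for x
  proof
    assume "x \<in> unit_space C u"
    then have x: "x \<in> generated_cone C u" "- x \<in> generated_cone C u"
      by (auto simp: unit_space_def)
    then have "x \<in> D"
      by (simp add: generated_iff)
    obtain l where l: "\<And>n. - l * c n u \<le> c n x"
      using x(1) by (auto simp: generated_iff)
    obtain l' where l': "\<And>n. - l' * c n u \<le> - c n x"
      using x(2) \<open>x \<in> D\<close> by (auto simp: generated_iff minus)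
    have "\<bar>c n x\<bar> \<le> max l l' * c n u" for n
    proof -
      have "l * c n u \<le> max l l' * c n u" "l' * c n u \<le> max l l' * c n u"
        using u(2)[of n] by (intro mult_right_mono; simp)+
      then show ?thesis
        using l[of n] l'[of n] by linarith
    qed
    then show "x \<in> D \<and> (\<exists>l. \<forall>n. \<bar>c n x\<bar> \<le> l * c n u)"
      using \<open>x \<in> D\<close> by blast
  next
    assume "x \<in> D \<and> (\<exists>l. \<forall>n. \<bar>c n x\<bar> \<le> l * c n u)"
    then obtain l where l: "x \<in> D" "\<And>n. \<bar>c n x\<bar> \<le> l * c n u"
      by blast
    \<comment> \<open>\<open>generated_cone\<close> asks for a positive factor, whereas
      \<open>l\<close> may be 0 or negative a priori; hence \<open>max l 1\<close>.\<close>
    have bounds: "- max l 1 * c n u \<le> c n x" "- max l 1 * c n u \<le> c n (- x)" for n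
    proof -
      have "l * c n u \<le> max l 1 * c n u"
        using u(2)[of n] by (intro mult_right_mono; simp)
      then show "- max l 1 * c n u \<le> c n x" "- max l 1 * c n u \<le> c n (- x)"
        using l(2)[of n] minus[OF l(1), of n] by linarith+
    qed
    have "0 < max l 1"
      by simp
    then have "x \<in> generated_cone C u" "- x \<in> generated_cone C u"
      unfolding generated_iff using l(1) subspace_neg[OF D(1) l(1)] bounds by blast+
    then show "x \<in> unit_space C u"
      unfolding unit_space_def by (metis IntI add.inverse_inverse imageI)
  qed
  \<comment> \<open>Where the quotients are unbounded \<open>Bcontfun\<close> gives no information,
    so the formula for \<open>T\<close> is established on \<open>unit_space C u\<close>.\<close>
  define T :: "'a \<Rightarrow> l_infinity" where "T x = Bcontfun (\<lambda>n. c n x / c n u)" for x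
  have T: "apply_bcontfun (T x) n = c n x / c n u" if x: "x \<in> unit_space C u" for x n
  proof -
    obtain l where "\<And>n. \<bar>c n x\<bar> \<le> l * c n u"
      using x unit_iff by blast
    then have "norm (c n x / c n u) \<le> l" for n
      using u(2)[of n] by (simp add: divide_le_eq)
    then have "(\<lambda>n. c n x / c n u) \<in> bcontfun"
      by (intro bcontfun_normI) auto
    then show ?thesis
      by (simp add: T_def Bcontfun_inverse)
  qed
  have sub_W: "subspace (unit_space C u)"
  proof (rule subspaceI)
    have "c n 0 = 0" for n
      using scale[OF subspace_0[OF D(1)], of n 0] by simp
    then show "0 \<in> unit_space C u"
      using subspace_0[OF D(1)] by (auto simp: unit_iff intro: exI[of _ 0])
  next
    fix x y assume "x \<in> unit_space C u" "y \<in> unit_space C u"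
    then obtain l l' where xy: "x \<in> D" "y \<in> D" "\<And>n. \<bar>c n x\<bar> \<le> l * c n u" "\<And>n. \<bar>c n y\<bar> \<le> l' * c n u"
      unfolding unit_iff by blast
    have "\<bar>c n (x + y)\<bar> \<le> (l + l') * c n u" for n
      using xy(3,4)[of n] add[OF xy(1,2), of n] by (simp add: distrib_right)
    then show "x + y \<in> unit_space C u"
      using xy D_simps unfolding unit_iff by blast
  next
    fix r x assume "x \<in> unit_space C u"
    then obtain l where x: "x \<in> D" "\<And>n. \<bar>c n x\<bar> \<le> l * c n u"
      unfolding unit_iff by blast
    have "\<bar>c n (r *\<^sub>R x)\<bar> \<le> (\<bar>r\<bar> * l) * c n u" for n
      using x mult_left_mono[of _ _ "\<bar>r\<bar>"] by (simp add: scale abs_mult mult.assoc)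
    then show "r *\<^sub>R x \<in> unit_space C u"
      using x D_simps unfolding unit_iff by blast
  qed
  have norm_T: "norm (T x) = unit_norm V C u x" if x: "x \<in> unit_space C u" for x
  proof -
    have "x \<in> D"
      using x unit_iff by blast
    have le_iff: "x \<in> (\<lambda>y. l *\<^sub>R y) ` sym_interval V C u \<longleftrightarrow> norm (T x) \<le> l" if "0 < l" for l
    proof -
      have "\<bar>c n x\<bar> \<le> l * c n u \<longleftrightarrow> norm (T x n) \<le> l" for n
        using u(2)[of n] by (simp add: T[OF x] divide_le_eq)
      then show ?thesis
        unfolding interval_iff[OF that] using \<open>x \<in> D\<close>
        by (meson norm_bound norm_bounded order_trans)
    qed
    have "{l. 0 < l \<and> x \<in> (\<lambda>y. l *\<^sub>R y) ` sym_interval V C u} = {l. 0 < l \<and> norm (T x) \<le> l}"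
      using le_iff by blast
    then have "unit_norm V C u x = Inf {l. 0 < l \<and> norm (T x) \<le> l}"
      by (simp only: unit_norm_def)
    also have "\<dots> = norm (T x)"
    proof (cases "norm (T x) = 0")
      case True
      then have "{l. 0 < l \<and> norm (T x) \<le> l} = {0<..}"
        by auto
      then show ?thesis
        using True by (simp only: cInf_greaterThan)
    next
      case False
      then have "0 < norm (T x)"
        by simp
      then have "{l. 0 < l \<and> norm (T x) \<le> l} = {norm (T x)..}"
        by (auto simp del: zero_less_norm_iff intro: less_le_trans)
      then show ?thesis
        by (simp only: cInf_atLeast)
    qed
    finally show ?thesis ..
  qed
  have inj: "inj_on T (unit_space C u)"
  proof (rule inj_onI)
    fix x y assume xy: "x \<in> unit_space C u" "y \<in> unit_space C u" "T x = T y"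
    then have "c n x / c n u = c n y / c n u" for n
      using T by metis
    then have "c n x = c n y" for n
      using u(2)[of n] by (metis divide_cancel_right less_numeral_extra(3))
    then show "x = y"
      using unique xy unit_iff by blast
  qed
  have surj: "g \<in> T ` unit_space C u" for g :: l_infinity
  proof -
    \<comment> \<open>Rescales \<open>g\<close> into the unit ball as \<open>multiplier\<close>
      requires; the summand 1 keeps \<open>d\<close> positive when \<open>g\<close> is 0.\<close>
    define d where "d = norm g + 1"
    have "0 < d"
      using norm_ge_zero[of g] by (simp add: d_def add_nonneg_pos)
    have "\<exists>y\<in>D. \<forall>n. c n y = (g n / d) * c n u"
    proof (rule multiplier)
      show "\<bar>g n / d\<bar> \<le> 1" for n
      proof -
        have "\<bar>g n\<bar> \<le> d"
          using norm_bounded[of g n] by (simp add: d_def)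
        then show ?thesis
          using \<open>0 < d\<close> by (simp add: abs_divide)
      qed
    qed
    then obtain y where y: "y \<in> D" "\<And>n. c n y = (g n / d) * c n u"
      by blast
    define x where "x = d *\<^sub>R y"
    have c_x: "c n x = g n * c n u" for n
      using y \<open>0 < d\<close> by (simp add: x_def scale)
    have "\<bar>c n x\<bar> \<le> norm g * c n u" for n
      using norm_bounded[of g n] u(2)[of n] by (simp add: c_x abs_mult)
    moreover have "x \<in> D"
      using y D_simps by (simp add: x_def)
    ultimately have "x \<in> unit_space C u"
      unfolding unit_iff by blast
    moreover have "T x n = g n" for n
      using u(2)[of n] by (simp add: T[OF calculation] c_x)
    then have "T x = g"
      by (intro bcontfun_eqI)
    ultimately show ?thesis
      by blast
  qed
  show ?thesis
    unfolding linearly_isometric_def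
  proof (intro conjI exI[of _ T] ballI allI)
    show "bij_betw T (unit_space C u) UNIV"
      using inj surj by (auto simp: bij_betw_def)
    show "T (x + y) = T x + T y" if "x \<in> unit_space C u" "y \<in> unit_space C u" for x y
    proof (rule bcontfun_eqI)
      show "T (x + y) n = (T x + T y) n" for n
        using that subspace_add[OF sub_W that] unit_iff by (simp add: T add add_divide_distrib)
    qed
    show "T (r *\<^sub>R x) = r *\<^sub>R T x" if "x \<in> unit_space C u" for r x
    proof (rule bcontfun_eqI)
      show "T (r *\<^sub>R x) n = (r *\<^sub>R T x) n" for n
        using that subspace_scale[OF sub_W that] unit_iff by (simp add: T scale)
    qed
  qed (auto simp: sub_W norm_T subspace_UNIV)
qed

theorem corollary2:
  fixes p :: real and u :: L0
  assumes "1 < p"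
    and "u \<in> nonsupport_points (Lp p) (Lp_norm p) (haar_cone p)"
  shows "linearly_isometric
           (unit_space (haar_cone p) u) (unit_norm (Lp p) (haar_cone p) u)
           (UNIV :: l_infinity set) norm"
proof (rule unit_space_linearly_isometric_l_infinity
    [where D = "haar_span p" and c = "\<lambda>n. haar_coeff (Suc n)"])
  have p: "1 \<le> p"
    using assms(1) by simp
  have Lp: "x \<in> Lp p" if "x \<in> haar_span p" for x
    using that by (simp add: haar_span_def)
  \<comment> \<open>The Haar system starts at index 1 and the sequences in \<open>l_infinity\<close>
    at 0, so coordinate \<open>n\<close> is the coefficient at \<open>Suc n\<close>.\<close>
  have all_Suc: "(\<forall>n\<ge>1. P n) \<longleftrightarrow> (\<forall>n. P (Suc n))" for P :: "nat \<Rightarrow> bool"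
    by (metis Suc_le_D Suc_le_mono One_nat_def le0)
  show "subspace (haar_span p)"
    by (rule subspace_haar_span[OF p])
  show "haar_span p \<subseteq> Lp p"
    using Lp by blast
  show "haar_coeff (Suc n) (x + y) = haar_coeff (Suc n) x + haar_coeff (Suc n) y"
    if "x \<in> haar_span p" "y \<in> haar_span p" for n x y
    by (rule haar_coeff_add[OF p Lp[OF that(1)] Lp[OF that(2)]])
  show "haar_coeff (Suc n) (r *\<^sub>R x) = r * haar_coeff (Suc n) x" for n r x
    by (rule haar_coeff_scaleR)
  show "x = y" if "x \<in> haar_span p" "y \<in> haar_span p"
    "\<And>n. haar_coeff (Suc n) x = haar_coeff (Suc n) y" for x y
  proof (rule haar_span_eqI[OF p that(1,2)])
    show "haar_coeff n x = haar_coeff n y" if "1 \<le> n" for n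
      using that \<open>\<And>n. haar_coeff (Suc n) x = haar_coeff (Suc n) y\<close>[of "n - 1"] by simp
  qed
  show "haar_cone p = {x \<in> haar_span p. \<forall>n. 0 \<le> haar_coeff (Suc n) x}"
    by (simp only: haar_cone_eq[OF p] all_Suc)
  show u: "u \<in> haar_span p"
    using assms(2) by (simp add: nonsupport_points_def haar_cone_eq[OF p])
  show "0 < haar_coeff (Suc n) u" for n
    by (rule nonsupport_haar_coeff_pos[OF assms]) simp
  \<comment> \<open>The multiplier is shifted to \<open>b (n - 1)\<close> to undo the offset between
    the two indexings.\<close>
  show "\<exists>y\<in>haar_span p. \<forall>n. haar_coeff (Suc n) y = b n * haar_coeff (Suc n) u"
    if "\<And>n. \<bar>b n\<bar> \<le> 1" for b :: "nat \<Rightarrow> real"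
    using haar_span_multiplier[OF assms(1) u, of "\<lambda>n. b (n - 1)"] that by (simp add: all_Suc del: One_nat_def)
qed

end
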